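(* A complex Finsler space $(M,F)$ of complex dimension $2$ is a complex Landsberg space if and only if $$FA(E-Y)=A_{|0}-FA(J+Y)\quad\text{and}\quad FB(E-Y)=B_{|0}-\frac{FB}2(J+Y).$$
   Context: $M$ is a complex manifold with $\dim_{\mathbb C}M=2$; $T'M$ is its holomorphic tangent bundle with local coordinates $(z^k,\eta^k)_{k=1,2}$; $\widetilde{T'M}$ is $T'M$ minus the zero section. A complex Finsler space $(M,F)$: $F:T'M\to[0,\infty)$ is continuous, $L:=F^2$ is smooth on $\widetilde{T'M}$, $F(z,\eta)=0$ iff $\eta=0$, $F(z,\lambda\eta)=|\lambda|F(z,\eta)$ for all $\lambda\in\mathbb C$, and the Hermitian matrix $g_{i\bar j}:=\partial^2L/\partial\eta^i\partial\bar\eta^j$ is positive definite on $\widetilde{T'M}$. Repeated indices are summed over $\{1,2\}$; everything lives on $\widetilde{T'M}$. $(g^{\bar m i})$ is the inverse matrix: $g^{\bar m i}g_{j\bar m}=\delta^i_j$. Chern–Finsler connection: $\dot\partial_k:=\partial/\partial\eta^k$, $N^k_j:=g^{\bar mk}\frac{\partial g_{l\bar m}}{\partial z^j}\eta^l$, $\delta_k:=\frac{\partial}{\partial z^k}-N^j_k\dot\partial_j$, $L^i_{jk}:=g^{\bar li}\delta_kg_{j\bar l}$, $C^i_{jk}:=g^{\bar li}\dot\partial_kg_{j\bar l}$. Canonical connection objects: $G^i:=\frac12N^i_j\eta^j$, $\overset{c}{N}{}^i_j:=\dot\partial_jG^i$, $\overset{c}{\delta}_k:=\frac{\partial}{\partial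 z^k}-\overset{c}{N}{}^j_k\dot\partial_j$, $\overset{B}{L}{}^i_{jk}:=\dot\partial_k\overset{c}{N}{}^i_j$ (Berwald type), $\overset{c}{L}{}^i_{jk}:=\frac12g^{\bar li}(\overset{c}{\delta}_kg_{j\bar l}+\overset{c}{\delta}_jg_{k\bar l})$ (Rund type). $(M,F)$ is a complex Landsberg space if $\overset{B}{L}{}^i_{jk}=\overset{c}{L}{}^i_{jk}$. In a fixed local chart: $l^i:=\eta^i/F$, $l_i:=\frac1Fg_{i\bar j}\bar\eta^j$, $g:=\det(g_{i\bar j})$, $m^1:=-l_2/\sqrt g$, $m^2:=l_1/\sqrt g$, $m_1:=-\sqrt g\,l^2$, $m_2:=\sqrt g\,l^1$. Put $A:=m^jm^kl_hC^h_{kj}$, $B:=m_hm^km^jC^h_{jk}$, $J:=l^jl^kl_iL^i_{jk}$, $Y:=m^jl^km_iL^i_{jk}$, $E:=l^jm^km_iL^i_{jk}$. For a function $f$, $f_{|0}:=\eta^k\delta_kf$. The two equations are required in every local chart (their validity is independent of the chart). *)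

theory Defs
  imports "HOL-Analysis.Analysis"
begin

section \<open>Smooth and holomorphic maps\<close>

primrec Ck_on :: "nat \<Rightarrow> ('a::real_normed_vector \<Rightarrow> 'b::real_normed_vector) \<Rightarrow> 'a set \<Rightarrow> bool" where
  "Ck_on 0 f S \<longleftrightarrow> continuous_on S f"
| "Ck_on (Suc k) f S \<longleftrightarrow> (\<forall>x\<in>S. f differentiable (at x)) \<and>
      (\<forall>v. Ck_on k (\<lambda>x. frechet_derivative f (at x) v) S)"

text \<open>Smoothness in the real sense; meaningful for open \<open>S\<close> only.\<close>
definition smooth_on :: "('a::real_normed_vector \<Rightarrow> 'b::real_normed_vector) \<Rightarrow> 'a set \<Rightarrow> bool" where
  "smooth_on f S \<longleftrightarrow> (\<forall>k. Ck_on k f S)"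

definition holomorphic_map_on ::
  "(complex^'n::finite \<Rightarrow> complex^'m::finite) \<Rightarrow> (complex^'n) set \<Rightarrow> bool" where
  "holomorphic_map_on f S \<longleftrightarrow>
     (\<forall>x\<in>S. \<exists>D. (f has_derivative D) (at x) \<and> Vector_Spaces.linear (*s) (*s) D)"


section \<open>Complex manifolds and the holomorphic tangent bundle\<close>

text \<open>A chart is a pair of its domain and its coordinate map.\<close>

type_synonym ('m, 'n) chart = "'m set \<times> ('m \<Rightarrow> complex^'n)"

definition chart_image :: "('m, 'n::finite) chart \<Rightarrow> (complex^'n) set" where
  "chart_image c = snd c ` fst c"

definition chart_inv :: "('m, 'n::finite) chart \<Rightarrow> complex^'n \<Rightarrow> 'm" where
  "chart_inv c = inv_into (fst c) (snd c)"

definition is_chart :: "'m topology \<Rightarrow> ('m, 'n::finite) chart \<Rightarrow> bool" where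
  "is_chart M c \<longleftrightarrow> openin M (fst c) \<and> open (chart_image c) \<and>
     homeomorphic_map (subtopology M (fst c)) (top_of_set (chart_image c)) (snd c)"

definition transition :: "('m, 'n::finite) chart \<Rightarrow> ('m, 'n) chart \<Rightarrow> complex^'n \<Rightarrow> complex^'n" where
  "transition c d = snd d \<circ> chart_inv c"

definition compatible :: "('m, 'n::finite) chart \<Rightarrow> ('m, 'n) chart \<Rightarrow> bool" where
  "compatible c d \<longleftrightarrow>
     holomorphic_map_on (transition c d) (snd c ` (fst c \<inter> fst d)) \<and>
     holomorphic_map_on (transition d c) (snd d ` (fst c \<inter> fst d))"

text \<open>The complex structure is given by its maximal atlas, so the local charts of the manifold are
  exactly the elements of \<open>\<A>\<close>. The complex dimension is \<open>CARD('n)\<close>.\<close>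
definition complex_manifold :: "'m topology \<Rightarrow> ('m, 'n::finite) chart set \<Rightarrow> bool" where
  "complex_manifold M \<A> \<longleftrightarrow>
     Hausdorff_space M \<and> second_countable M \<and>
     (\<forall>c\<in>\<A>. is_chart M c) \<and>
     (\<Union>c\<in>\<A>. fst c) = topspace M \<and>
     (\<forall>c\<in>\<A>. \<forall>d\<in>\<A>. compatible c d) \<and>
     (\<forall>c. is_chart M c \<and> (\<forall>d\<in>\<A>. compatible c d) \<longrightarrow> c \<in> \<A>)"

definition charts_at :: "('m, 'n::finite) chart set \<Rightarrow> 'm \<Rightarrow> ('m, 'n) chart set" where
  "charts_at \<A> p = {c\<in>\<A>. p \<in> fst c}"

text \<open>A holomorphic tangent vector at \<open>p\<close> is the family \<open>X\<close> of its component vectors \<open>X c\<close> in all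
  local charts \<open>c\<close> at \<open>p\<close>, transforming by the (complex linear) Jacobian of the change of
  coordinates. Outside the charts at \<open>p\<close> the value is the dummy \<open>undefined\<close>.\<close>

type_synonym ('m, 'n) tangent = "('m, 'n) chart \<Rightarrow> complex^'n"

definition tangent_space :: "('m, 'n::finite) chart set \<Rightarrow> 'm \<Rightarrow> ('m, 'n) tangent set" where
  "tangent_space \<A> p = {X \<in> extensional (charts_at \<A> p).
     \<forall>c\<in>charts_at \<A> p. \<forall>d\<in>charts_at \<A> p.
       X d = frechet_derivative (transition c d) (at (snd c p)) (X c)}"

definition tangent_zero :: "('m, 'n::finite) chart set \<Rightarrow> 'm \<Rightarrow> ('m, 'n) tangent" where
  "tangent_zero \<A> p = (\<lambda>c\<in>charts_at \<A> p. 0)"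

definition tangent_scale ::
  "('m, 'n::finite) chart set \<Rightarrow> 'm \<Rightarrow> complex \<Rightarrow> ('m, 'n) tangent \<Rightarrow> ('m, 'n) tangent" where
  "tangent_scale \<A> p a X = (\<lambda>c\<in>charts_at \<A> p. a *s X c)"

definition tangent_bundle :: "'m topology \<Rightarrow> ('m, 'n::finite) chart set \<Rightarrow> ('m \<times> ('m, 'n) tangent) set" where
  "tangent_bundle M \<A> = (SIGMA p:topspace M. tangent_space \<A> p)"

text \<open>The element of the bundle with coordinates \<open>(z, \<eta>)\<close> in the bundle chart induced by \<open>c\<close>.\<close>
definition bundle_point ::
  "('m, 'n::finite) chart set \<Rightarrow> ('m, 'n) chart \<Rightarrow> (complex^'n) \<times> (complex^'n) \<Rightarrow> 'm \<times> ('m, 'n) tangent" where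
  "bundle_point \<A> c = (\<lambda>(z, \<eta>). let p = chart_inv c z in
     (p, \<lambda>d\<in>charts_at \<A> p. frechet_derivative (transition c d) (at z) \<eta>))"

definition local_rep ::
  "('m, 'n::finite) chart set \<Rightarrow> ('m, 'n) chart \<Rightarrow> ('m \<times> ('m, 'n) tangent \<Rightarrow> real) \<Rightarrow>
     (complex^'n) \<times> (complex^'n) \<Rightarrow> real" where
  "local_rep \<A> c F = F \<circ> bundle_point \<A> c"


section \<open>Complex Finsler geometry in a chart\<close>

text \<open>Below, \<open>f\<close> is the expression \<open>F(z, \<eta>)\<close> of the Finsler function in a chart, points are pairs
  \<open>(z, \<eta>)\<close>, and coefficients carry upper indices before lower ones.
  The operators \<open>d_z\<close>, \<open>d_eta\<close>, \<open>d_etabar\<close> are Wirtinger derivatives: \<open>(\<partial>/\<partial>x - \<i> \<partial>/\<partial>y)/2\<close> in a complex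
  variable \<open>x + \<i> y\<close> and \<open>(\<partial>/\<partial>x + \<i> \<partial>/\<partial>y)/2\<close> in its conjugate.\<close>

type_synonym 'n pt = "(complex^'n) \<times> (complex^'n)"

definition d_z :: "'n::finite \<Rightarrow> ('n pt \<Rightarrow> complex) \<Rightarrow> 'n pt \<Rightarrow> complex" where
  "d_z k h p = (frechet_derivative h (at p) (axis k 1, 0)
                - \<i> * frechet_derivative h (at p) (axis k \<i>, 0)) / 2"

definition d_eta :: "'n::finite \<Rightarrow> ('n pt \<Rightarrow> complex) \<Rightarrow> 'n pt \<Rightarrow> complex" where
  "d_eta k h p = (frechet_derivative h (at p) (0, axis k 1)
                  - \<i> * frechet_derivative h (at p) (0, axis k \<i>)) / 2"

definition d_etabar :: "'n::finite \<Rightarrow> ('n pt \<Rightarrow> complex) \<Rightarrow> 'n pt \<Rightarrow> complex" where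
  "d_etabar k h p = (frechet_derivative h (at p) (0, axis k 1)
                     + \<i> * frechet_derivative h (at p) (0, axis k \<i>)) / 2"

text \<open>The second index of \<open>gdown\<close> and the first index of \<open>gup\<close> are the barred ones.\<close>
definition gdown :: "('n::finite pt \<Rightarrow> real) \<Rightarrow> 'n \<Rightarrow> 'n \<Rightarrow> 'n pt \<Rightarrow> complex" where
  "gdown f i j = d_eta i (d_etabar j (\<lambda>p. of_real ((f p)\<^sup>2)))"

definition gmat :: "('n::finite pt \<Rightarrow> real) \<Rightarrow> 'n pt \<Rightarrow> complex^'n^'n" where
  "gmat f p = (\<chi> i j. gdown f i j p)"

text \<open>Normalised by \<open>(\<Sum>m\<in>UNIV. gdown f j m p * gup f m i p) = (if i = j then 1 else 0)\<close>.\<close>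
definition gup :: "('n::finite pt \<Rightarrow> real) \<Rightarrow> 'n \<Rightarrow> 'n \<Rightarrow> 'n pt \<Rightarrow> complex" where
  "gup f m i p = matrix_inv (gmat f p) $ m $ i"

definition pos_def_hermitian :: "complex^'n^'n::finite \<Rightarrow> bool" where
  "pos_def_hermitian A \<longleftrightarrow> (\<forall>i j. A $ j $ i = cnj (A $ i $ j)) \<and>
     (\<forall>v. v \<noteq> 0 \<longrightarrow> 0 < Re (\<Sum>i\<in>UNIV. \<Sum>j\<in>UNIV. A $ i $ j * v $ i * cnj (v $ j)))"


subsection \<open>Chern--Finsler connection\<close>

definition N_cf :: "('n::finite pt \<Rightarrow> real) \<Rightarrow> 'n \<Rightarrow> 'n \<Rightarrow> 'n pt \<Rightarrow> complex" where
  "N_cf f k j p = (\<Sum>m\<in>UNIV. \<Sum>l\<in>UNIV. gup f m k p * d_z j (gdown f l m) p * snd p $ l)"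

definition delta_cf :: "('n::finite pt \<Rightarrow> real) \<Rightarrow> 'n \<Rightarrow> ('n pt \<Rightarrow> complex) \<Rightarrow> 'n pt \<Rightarrow> complex" where
  "delta_cf f k h p = d_z k h p - (\<Sum>j\<in>UNIV. N_cf f j k p * d_eta j h p)"

definition L_cf :: "('n::finite pt \<Rightarrow> real) \<Rightarrow> 'n \<Rightarrow> 'n \<Rightarrow> 'n \<Rightarrow> 'n pt \<Rightarrow> complex" where
  "L_cf f i j k p = (\<Sum>l\<in>UNIV. gup f l i p * delta_cf f k (gdown f j l) p)"

definition C_cf :: "('n::finite pt \<Rightarrow> real) \<Rightarrow> 'n \<Rightarrow> 'n \<Rightarrow> 'n \<Rightarrow> 'n pt \<Rightarrow> complex" where
  "C_cf f i j k p = (\<Sum>l\<in>UNIV. gup f l i p * d_eta k (gdown f j l) p)"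

text \<open>\<open>h\<^bsub>|0\<^esub>\<close> for a function \<open>h\<close>.\<close>
definition bar0 :: "('n::finite pt \<Rightarrow> real) \<Rightarrow> ('n pt \<Rightarrow> complex) \<Rightarrow> 'n pt \<Rightarrow> complex" where
  "bar0 f h p = (\<Sum>k\<in>UNIV. snd p $ k * delta_cf f k h p)"


subsection \<open>Canonical connection, Berwald and Rund type coefficients\<close>

definition spray :: "('n::finite pt \<Rightarrow> real) \<Rightarrow> 'n \<Rightarrow> 'n pt \<Rightarrow> complex" where
  "spray f i p = (\<Sum>j\<in>UNIV. N_cf f i j p * snd p $ j) / 2"

definition N_can :: "('n::finite pt \<Rightarrow> real) \<Rightarrow> 'n \<Rightarrow> 'n \<Rightarrow> 'n pt \<Rightarrow> complex" where
  "N_can f i j = d_eta j (spray f i)"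

definition delta_can :: "('n::finite pt \<Rightarrow> real) \<Rightarrow> 'n \<Rightarrow> ('n pt \<Rightarrow> complex) \<Rightarrow> 'n pt \<Rightarrow> complex" where
  "delta_can f k h p = d_z k h p - (\<Sum>j\<in>UNIV. N_can f j k p * d_eta j h p)"

definition L_berwald :: "('n::finite pt \<Rightarrow> real) \<Rightarrow> 'n \<Rightarrow> 'n \<Rightarrow> 'n \<Rightarrow> 'n pt \<Rightarrow> complex" where
  "L_berwald f i j k = d_eta k (N_can f i j)"

definition L_rund :: "('n::finite pt \<Rightarrow> real) \<Rightarrow> 'n \<Rightarrow> 'n \<Rightarrow> 'n \<Rightarrow> 'n pt \<Rightarrow> complex" where
  "L_rund f i j k p = (\<Sum>l\<in>UNIV. gup f l i p *
     (delta_can f k (gdown f j l) p + delta_can f j (gdown f k l) p)) / 2"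


section \<open>Complex Finsler and Landsberg spaces\<close>

text \<open>As usual for bundles, continuity of \<open>F\<close> on \<open>T'M\<close> and smoothness of \<open>F\<^sup>2\<close> off the zero section
  are expressed in the bundle charts induced by the charts of the manifold.\<close>
definition complex_finsler_space ::
  "'m topology \<Rightarrow> ('m, 'n::finite) chart set \<Rightarrow> ('m \<times> ('m, 'n) tangent \<Rightarrow> real) \<Rightarrow> bool" where
  "complex_finsler_space M \<A> F \<longleftrightarrow>
     complex_manifold M \<A> \<and>
     (\<forall>v\<in>tangent_bundle M \<A>. 0 \<le> F v) \<and>
     (\<forall>c\<in>\<A>. continuous_on (chart_image c \<times> UNIV) (local_rep \<A> c F)) \<and>
     (\<forall>c\<in>\<A>. smooth_on (\<lambda>p. (local_rep \<A> c F p)\<^sup>2) (chart_image c \<times> (- {0}))) \<and>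
     (\<forall>(p, X)\<in>tangent_bundle M \<A>. F (p, X) = 0 \<longleftrightarrow> X = tangent_zero \<A> p) \<and>
     (\<forall>(p, X)\<in>tangent_bundle M \<A>. \<forall>a. F (p, tangent_scale \<A> p a X) = cmod a * F (p, X)) \<and>
     (\<forall>c\<in>\<A>. \<forall>p\<in>chart_image c \<times> (- {0}). pos_def_hermitian (gmat (local_rep \<A> c F) p))"

definition complex_landsberg_space ::
  "'m topology \<Rightarrow> ('m, 'n::finite) chart set \<Rightarrow> ('m \<times> ('m, 'n) tangent \<Rightarrow> real) \<Rightarrow> bool" where
  "complex_landsberg_space M \<A> F \<longleftrightarrow>
     complex_finsler_space M \<A> F \<and>
     (\<forall>c\<in>\<A>. \<forall>p\<in>chart_image c \<times> (- {0}). \<forall>i j k.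
        L_berwald (local_rep \<A> c F) i j k p = L_rund (local_rep \<A> c F) i j k p)"


section \<open>The Berwald frame in complex dimension two\<close>

text \<open>The indices are the two elements \<open>1\<close> and \<open>2\<close> of the type \<open>2\<close>.\<close>

definition l_up :: "(2 pt \<Rightarrow> real) \<Rightarrow> 2 \<Rightarrow> 2 pt \<Rightarrow> complex" where
  "l_up f i p = snd p $ i / of_real (f p)"

definition l_down :: "(2 pt \<Rightarrow> real) \<Rightarrow> 2 \<Rightarrow> 2 pt \<Rightarrow> complex" where
  "l_down f i p = (\<Sum>j\<in>UNIV. gdown f i j p * cnj (snd p $ j)) / of_real (f p)"

text \<open>The determinant of the positive definite Hermitian matrix \<open>gmat f p\<close> is a positive real, whose
  principal complex square root is the positive one.\<close>
definition sqrt_g :: "(2 pt \<Rightarrow> real) \<Rightarrow> 2 pt \<Rightarrow> complex" where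
  "sqrt_g f p = csqrt (det (gmat f p))"

definition m_up :: "(2 pt \<Rightarrow> real) \<Rightarrow> 2 \<Rightarrow> 2 pt \<Rightarrow> complex" where
  "m_up f i p = (if i = 1 then - l_down f 2 p / sqrt_g f p else l_down f 1 p / sqrt_g f p)"

definition m_down :: "(2 pt \<Rightarrow> real) \<Rightarrow> 2 \<Rightarrow> 2 pt \<Rightarrow> complex" where
  "m_down f i p = (if i = 1 then - sqrt_g f p * l_up f 2 p else sqrt_g f p * l_up f 1 p)"

definition scal_A :: "(2 pt \<Rightarrow> real) \<Rightarrow> 2 pt \<Rightarrow> complex" where
  "scal_A f p = (\<Sum>j\<in>UNIV. \<Sum>k\<in>UNIV. \<Sum>h\<in>UNIV.
     m_up f j p * m_up f k p * l_down f h p * C_cf f h k j p)"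

definition scal_B :: "(2 pt \<Rightarrow> real) \<Rightarrow> 2 pt \<Rightarrow> complex" where
  "scal_B f p = (\<Sum>h\<in>UNIV. \<Sum>k\<in>UNIV. \<Sum>j\<in>UNIV.
     m_down f h p * m_up f k p * m_up f j p * C_cf f h j k p)"

definition scal_J :: "(2 pt \<Rightarrow> real) \<Rightarrow> 2 pt \<Rightarrow> complex" where
  "scal_J f p = (\<Sum>j\<in>UNIV. \<Sum>k\<in>UNIV. \<Sum>i\<in>UNIV.
     l_up f j p * l_up f k p * l_down f i p * L_cf f i j k p)"

definition scal_Y :: "(2 pt \<Rightarrow> real) \<Rightarrow> 2 pt \<Rightarrow> complex" where
  "scal_Y f p = (\<Sum>j\<in>UNIV. \<Sum>k\<in>UNIV. \<Sum>i\<in>UNIV.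
     m_up f j p * l_up f k p * m_down f i p * L_cf f i j k p)"

definition scal_E :: "(2 pt \<Rightarrow> real) \<Rightarrow> 2 pt \<Rightarrow> complex" where
  "scal_E f p = (\<Sum>j\<in>UNIV. \<Sum>k\<in>UNIV. \<Sum>i\<in>UNIV.
     l_up f j p * m_up f k p * m_down f i p * L_cf f i j k p)"

end

theory Submission
  imports Defs
begin

text \<open>Write \<open>D = \<eta>\<^sup>k\<delta>\<^sub>k\<close> (the operator \<open>bar0\<close>) and \<open>L\<^sup>i\<^sub>j\<^sub>0 = L\<^sup>i\<^sub>j\<^sub>k\<eta>\<^sup>k\<close>. Lowering the index \<open>i\<close> of \<open>G\<^sup>i\<close> and
  differentiating twice in \<open>\<eta>\<close> shows that twice the difference of the Berwald and Rund coefficients is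
  the tensor \<open>\<Lambda>\<^sup>h\<^sub>j\<^sub>k = D C\<^sup>h\<^sub>j\<^sub>k + L\<^sup>h\<^sub>i\<^sub>0 C\<^sup>i\<^sub>j\<^sub>k - C\<^sup>h\<^sub>i\<^sub>j N\<^sup>i\<^sub>k - C\<^sup>h\<^sub>i\<^sub>k N\<^sup>i\<^sub>j\<close> with the canonical \<open>N\<close>, for which
  \<open>2 N\<^sup>i\<^sub>j\<close> is \<open>L\<^sup>i\<^sub>j\<^sub>0\<close> plus the Chern--Finsler coefficient. By homogeneity \<open>\<Lambda>\<close> and \<open>C\<close> are symmetric in
  \<open>j, k\<close> and killed by \<open>\<eta>\<^sup>k\<close>, so in dimension two \<open>C\<^sup>h\<^sub>j\<^sub>k = m\<^sub>j m\<^sub>k (A l\<^sup>h + B m\<^sup>h)\<close>, and \<open>\<Lambda>\<close> vanishes iff its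
  contractions with \<open>m\<^sup>j m\<^sup>k l\<^sub>h\<close> and \<open>m\<^sup>j m\<^sup>k m\<^sub>h\<close> do. The derivation \<open>D\<close> kills \<open>F\<close>, acts on \<open>l\<close> through
  \<open>L\<^sup>i\<^sub>j\<^sub>0\<close>, and acts on \<open>m\<close> in the same way up to half of the trace \<open>L\<^sup>i\<^sub>i\<^sub>0 = F (J + Y)\<close>, which comes from
  \<open>\<surd>g\<close>. Hence the two contractions are \<open>D A - F A (E + J)\<close> and \<open>D B - F B (E + J / 2 - Y / 2)\<close>.\<close>

section \<open>Smooth functions\<close>

text \<open>A derivative at a point of the open set \<open>S\<close> sees only values in
  \<open>S\<close>, so agreement on \<open>S\<close> passes to all directional derivatives.
  Generalising over \<open>f\<close> and \<open>g\<close> lets the induction descend to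
  them.\<close>

lemma Ck_on_cong:
  assumes "open S" "\<And>x. x \<in> S \<Longrightarrow> f x = g x"
  shows "Ck_on k f S \<longleftrightarrow> Ck_on k g S"
  using assms(2)
proof (induction k arbitrary: f g)
  case 0
  then show ?case by (simp cong: continuous_on_cong)
next
  case (Suc k)
  have "f differentiable (at x) \<longleftrightarrow> g differentiable (at x)" if "x \<in> S" for x
    using has_derivative_transform_within_open[OF _ assms(1) that] Suc.prems
    unfolding differentiable_def by (metis (no_types, lifting))
  moreover have "Ck_on k (\<lambda>x. frechet_derivative f (at x) v) S
      \<longleftrightarrow> Ck_on k (\<lambda>x. frechet_derivative g (at x) v) S"
    if "\<forall>x\<in>S. f differentiable (at x)" for v
  proof (rule Suc.IH)
    show "frechet_derivative f (at x) v = frechet_derivative g (at x) v" if "x \<in> S" for x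
      using frechet_derivative_transform_within_open[OF _ assms(1) that Suc.prems]
        \<open>\<forall>x\<in>S. f differentiable (at x)\<close> that by simp
  qed
  ultimately show ?case by auto
qed

lemma Ck_on_Suc_imp: "Ck_on (Suc k) f S \<Longrightarrow> Ck_on k f S"
proof (induction k arbitrary: f)
  case 0
  then show ?case
    by (simp add: differentiable_imp_continuous_on differentiable_at_imp_differentiable_on)
next
  case (Suc k)
  then show ?case by (metis Ck_on.simps(2))
qed

lemma Ck_on_bounded_linear:
  assumes "bounded_linear h" "open S"
  shows "Ck_on k f S \<Longrightarrow> Ck_on k (\<lambda>x. h (f x)) S"
proof (induction k arbitrary: f)
  case 0
  then show ?case
    using bounded_linear.continuous_on[OF assms(1)] by simp
next
  case (Suc k)
  have d: "((\<lambda>x. h (f x)) has_derivative (\<lambda>v. h (frechet_derivative f (at x) v))) (at x)"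
    if "x \<in> S" for x
    using Suc.prems that
    by (intro bounded_linear.has_derivative[OF assms(1)]) (simp flip: frechet_derivative_works)
  have "Ck_on k (\<lambda>x. frechet_derivative (\<lambda>x. h (f x)) (at x) v) S
      \<longleftrightarrow> Ck_on k (\<lambda>x. h (frechet_derivative f (at x) v)) S" for v
    by (rule Ck_on_cong[OF assms(2)]) (simp flip: frechet_derivative_at[OF d])
  moreover have "Ck_on k (\<lambda>x. h (frechet_derivative f (at x) v)) S" for v
    using Suc by simp
  ultimately show ?case
    using d by (auto simp: differentiable_def)
qed

lemma Ck_on_add:
  assumes "open S"
  shows "Ck_on k f S \<Longrightarrow> Ck_on k g S \<Longrightarrow> Ck_on k (\<lambda>x. f x + g x) S"
proof (induction k arbitrary: f g)
  case 0
  then show ?case by (simp add: continuous_on_add)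
next
  case (Suc k)
  have d: "((\<lambda>x. f x + g x) has_derivative
      (\<lambda>v. frechet_derivative f (at x) v + frechet_derivative g (at x) v)) (at x)"
    if "x \<in> S" for x
    using Suc.prems that by (intro has_derivative_add) (simp_all flip: frechet_derivative_works)
  have "Ck_on k (\<lambda>x. frechet_derivative (\<lambda>x. f x + g x) (at x) v) S
      \<longleftrightarrow> Ck_on k (\<lambda>x. frechet_derivative f (at x) v + frechet_derivative g (at x) v) S" for v
    by (rule Ck_on_cong[OF assms]) (simp flip: frechet_derivative_at[OF d])
  moreover have "Ck_on k (\<lambda>x. frechet_derivative f (at x) v + frechet_derivative g (at x) v) S" for v
    using Suc by simp
  ultimately show ?case
    using d by (auto simp: differentiable_def)
qed

lemma Ck_on_const [simp]: "Ck_on k (\<lambda>x. c) S"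
  by (induction k arbitrary: c) auto

text \<open>The product rule pairs a derivative of class \<open>k\<close> with an undifferentiated
  factor of class \<open>Suc k\<close>. \<open>Ck_on_Suc_imp\<close> lowers the latter, and the
  induction hypothesis for arbitrary pairs covers both products.\<close>

lemma Ck_on_mult:
  fixes f g :: "'a::real_normed_vector \<Rightarrow> 'b::real_normed_algebra"
  assumes "open S"
  shows "Ck_on k f S \<Longrightarrow> Ck_on k g S \<Longrightarrow> Ck_on k (\<lambda>x. f x * g x) S"
proof (induction k arbitrary: f g)
  case 0
  then show ?case by (simp add: continuous_on_mult)
next
  case (Suc k)
  have d: "((\<lambda>x. f x * g x) has_derivative
      (\<lambda>v. f x * frechet_derivative g (at x) v + frechet_derivative f (at x) v * g x)) (at x)"
    if "x \<in> S" for x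
    using Suc.prems that by (intro has_derivative_mult) (simp_all flip: frechet_derivative_works)
  have "Ck_on k (\<lambda>x. frechet_derivative (\<lambda>x. f x * g x) (at x) v) S
      \<longleftrightarrow> Ck_on k (\<lambda>x. f x * frechet_derivative g (at x) v + frechet_derivative f (at x) v * g x) S"
    for v
    by (rule Ck_on_cong[OF assms]) (simp flip: frechet_derivative_at[OF d])
  moreover have "Ck_on k (\<lambda>x. f x * frechet_derivative g (at x) v + frechet_derivative f (at x) v * g x) S"
    for v
    using Suc.prems Suc.prems[THEN Ck_on_Suc_imp] by (intro Ck_on_add[OF assms] Suc.IH) simp_all
  ultimately show ?case
    using d by (auto simp: differentiable_def)
qed

text \<open>The derivative of the inverse is a product of the inverse itself with a derivative of
  \<open>f\<close>, so the induction needs only the same \<open>f\<close> one level down together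
  with \<open>Ck_on_mult\<close>.\<close>

lemma Ck_on_inverse:
  fixes f :: "'a::real_normed_vector \<Rightarrow> 'b::real_normed_div_algebra"
  assumes "open S" "\<And>x. x \<in> S \<Longrightarrow> f x \<noteq> 0"
  shows "Ck_on k f S \<Longrightarrow> Ck_on k (\<lambda>x. inverse (f x)) S"
proof (induction k)
  case 0
  then show ?case using assms by (simp add: continuous_on_inverse)
next
  case (Suc k)
  have d: "((\<lambda>x. inverse (f x)) has_derivative
      (\<lambda>v. - (inverse (f x) * frechet_derivative f (at x) v * inverse (f x)))) (at x)"
    if "x \<in> S" for x
    using Suc.prems that assms
    by (intro Deriv.has_derivative_inverse) (simp_all flip: frechet_derivative_works)
  have "Ck_on k (\<lambda>x. frechet_derivative (\<lambda>x. inverse (f x)) (at x) v) S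
      \<longleftrightarrow> Ck_on k (\<lambda>x. - (inverse (f x) * frechet_derivative f (at x) v * inverse (f x))) S"
    for v
    by (rule Ck_on_cong[OF assms(1)]) (simp flip: frechet_derivative_at[OF d])
  moreover have "Ck_on k (\<lambda>x. - (inverse (f x) * frechet_derivative f (at x) v * inverse (f x))) S"
    for v
    using Suc.prems Suc.prems[THEN Ck_on_Suc_imp] Suc.IH
    by (intro Ck_on_bounded_linear[OF bounded_linear_minus[OF bounded_linear_ident] assms(1)]
        Ck_on_mult[OF assms(1)]) simp_all
  ultimately show ?case
    using d by (auto simp: differentiable_def)
qed

section \<open>Closure properties of smooth functions\<close>

lemma smooth_on_cong:
  "open S \<Longrightarrow> (\<And>x. x \<in> S \<Longrightarrow> f x = g x) \<Longrightarrow> smooth_on f S \<longleftrightarrow> smooth_on g S"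
  unfolding smooth_on_def using Ck_on_cong by blast

lemma smooth_on_const [simp]: "smooth_on (\<lambda>x. c) S"
  by (simp add: smooth_on_def)

lemma smooth_on_bounded_linear_compose:
  "bounded_linear h \<Longrightarrow> open S \<Longrightarrow> smooth_on f S \<Longrightarrow> smooth_on (\<lambda>x. h (f x)) S"
  unfolding smooth_on_def using Ck_on_bounded_linear by blast

lemma smooth_on_add:
  "open S \<Longrightarrow> smooth_on f S \<Longrightarrow> smooth_on g S \<Longrightarrow> smooth_on (\<lambda>x. f x + g x) S"
  by (simp add: smooth_on_def Ck_on_add)

lemma smooth_on_mult:
  fixes f g :: "'a::real_normed_vector \<Rightarrow> 'b::real_normed_algebra"
  shows "open S \<Longrightarrow> smooth_on f S \<Longrightarrow> smooth_on g S \<Longrightarrow> smooth_on (\<lambda>x. f x * g x) S"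
  by (simp add: smooth_on_def Ck_on_mult)

lemma smooth_on_divide:
  fixes f g :: "'a::real_normed_vector \<Rightarrow> 'b::real_normed_field"
  assumes "open S" "\<And>x. x \<in> S \<Longrightarrow> g x \<noteq> 0" "smooth_on f S" "smooth_on g S"
  shows "smooth_on (\<lambda>x. f x / g x) S"
  unfolding divide_inverse using assms by (simp add: smooth_on_def Ck_on_mult Ck_on_inverse)

lemma smooth_on_sum:
  "open S \<Longrightarrow> (\<And>i. i \<in> I \<Longrightarrow> smooth_on (f i) S) \<Longrightarrow> smooth_on (\<lambda>x. \<Sum>i\<in>I. f i x) S"
  by (induction I rule: infinite_finite_induct) (simp_all add: smooth_on_add)

lemma smooth_on_prod:
  fixes f :: "'i \<Rightarrow> 'a::real_normed_vector \<Rightarrow> 'b::{real_normed_algebra, comm_ring_1}"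
  shows "open S \<Longrightarrow> (\<And>i. i \<in> I \<Longrightarrow> smooth_on (f i) S) \<Longrightarrow> smooth_on (\<lambda>x. \<Prod>i\<in>I. f i x) S"
  by (induction I rule: infinite_finite_induct) (simp_all add: smooth_on_mult)

lemma smooth_on_bounded_linear: "bounded_linear h \<Longrightarrow> smooth_on h S"
  unfolding smooth_on_def
proof
  fix k assume h: "bounded_linear h"
  then have "frechet_derivative h (at x) = h" for x
    by (metis bounded_linear_imp_has_derivative frechet_derivative_at)
  with h show "Ck_on k h S"
    by (cases k) (auto simp: linear_continuous_on bounded_linear_imp_differentiable)
qed

lemma smooth_on_differentiable: "smooth_on f S \<Longrightarrow> x \<in> S \<Longrightarrow> f differentiable (at x)"
  unfolding smooth_on_def by (metis Ck_on.simps(2))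

lemma smooth_on_frechet_derivative:
  "smooth_on f S \<Longrightarrow> smooth_on (\<lambda>x. frechet_derivative f (at x) v) S"
  unfolding smooth_on_def by (metis Ck_on.simps(2))

section \<open>Symmetry of the second derivative\<close>

text \<open>The second difference is symmetric in \<open>u\<close> and \<open>v\<close>, while the
  mixed derivative has a fixed order; comparing the two orders is the purpose. The mean value
  theorem is applied twice, first along \<open>u\<close>, then along \<open>v\<close>.\<close>

lemma second_difference_mvt:
  fixes f :: "'a::real_normed_vector \<Rightarrow> real"
  assumes S: "ball x r \<subseteq> S" and f: "Ck_on 2 f S"
    and h: "0 < h" "h * (norm u + norm v) < r"
  shows "\<exists>y\<in>cball x (h * (norm u + norm v)).
    f (x + h *\<^sub>R u + h *\<^sub>R v) - f (x + h *\<^sub>R u) - f (x + h *\<^sub>R v) + f x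
      = h * h * frechet_derivative (\<lambda>y. frechet_derivative f (at y) u) (at y) v"
proof -
  have fd: "(f has_derivative frechet_derivative f (at y)) (at y)"
    and fdd: "((\<lambda>y. frechet_derivative f (at y) u) has_derivative
      frechet_derivative (\<lambda>y. frechet_derivative f (at y) u) (at y)) (at y)" if "y \<in> ball x r" for y
    using S f that unfolding numeral_2_eq_2 by (auto simp flip: frechet_derivative_works)
  have near: "norm (s *\<^sub>R u + t *\<^sub>R v) \<le> h * (norm u + norm v)"
    if "0 \<le> s" "s \<le> h" "0 \<le> t" "t \<le> h" for s t
    using norm_triangle_ineq[of "s *\<^sub>R u" "t *\<^sub>R v"] that
      mult_right_mono[of s h "norm u"] mult_right_mono[of t h "norm v"]
    by (simp add: algebra_simps)
  have inb: "x + s *\<^sub>R u + t *\<^sub>R v \<in> ball x r" if "0 \<le> s" "s \<le> h" "0 \<le> t" "t \<le> h" for s t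
    using near[OF that] h(2) norm_minus_cancel[of "s *\<^sub>R u + t *\<^sub>R v"]
    by (simp add: dist_norm add.assoc)
  \<comment> \<open>The second difference is the increment of \<open>\<phi>\<close> over
    \<open>[0, h]\<close>, and the derivative of \<open>\<phi>\<close> is in turn an increment of
    the \<open>u\<close>-derivative of \<open>f\<close> along \<open>v\<close>.\<close>
  define \<phi> where "\<phi> s = f (x + s *\<^sub>R u + h *\<^sub>R v) - f (x + s *\<^sub>R u)" for s
  have d1: "((\<lambda>s. f (x + s *\<^sub>R u + t *\<^sub>R v)) has_derivative
      (\<lambda>e. e * frechet_derivative f (at (x + s *\<^sub>R u + t *\<^sub>R v)) u)) (at s)"
    if "0 \<le> s" "s \<le> h" "0 \<le> t" "t \<le> h" for s t
  proof -
    have "((\<lambda>s. f (x + s *\<^sub>R u + t *\<^sub>R v)) has_derivative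
      (\<lambda>e. frechet_derivative f (at (x + s *\<^sub>R u + t *\<^sub>R v)) (e *\<^sub>R u))) (at s)"
      by (rule has_derivative_compose[where f = "\<lambda>s. x + s *\<^sub>R u + t *\<^sub>R v" and g = f,
            OF _ fd[OF inb[OF that]]])
        (auto intro!: derivative_eq_intros)
    then show ?thesis
      using linear_cmul[OF has_derivative_linear[OF fd[OF inb[OF that]]]] by simp
  qed
  have diff_eq: "(\<lambda>e. e * a - e * b) = (*) (a - b)" for a b :: real
    by (auto simp: algebra_simps)
  have "\<exists>\<theta>. 0 < \<theta> \<and> \<theta> < h \<and> \<phi> h - \<phi> 0 = (h - 0) *
     (frechet_derivative f (at (x + \<theta> *\<^sub>R u + h *\<^sub>R v)) u - frechet_derivative f (at (x + \<theta> *\<^sub>R u)) u)"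
  proof (rule MVT2[OF h(1)])
    fix s assume s: "0 \<le> s" "s \<le> h"
    show "(\<phi> has_real_derivative frechet_derivative f (at (x + s *\<^sub>R u + h *\<^sub>R v)) u
        - frechet_derivative f (at (x + s *\<^sub>R u)) u) (at s)"
      unfolding \<phi>_def
      using has_derivative_diff[OF d1[OF s, of h] d1[OF s, of 0]] h
      by (simp add: has_field_derivative_def flip: diff_eq)
  qed
  then obtain \<theta> where \<theta>: "0 < \<theta>" "\<theta> < h" and eq1: "\<phi> h - \<phi> 0 = h *
     (frechet_derivative f (at (x + \<theta> *\<^sub>R u + h *\<^sub>R v)) u - frechet_derivative f (at (x + \<theta> *\<^sub>R u)) u)"
    by auto
  have "\<exists>\<tau>. 0 < \<tau> \<and> \<tau> < h \<and> frechet_derivative f (at (x + \<theta> *\<^sub>R u + h *\<^sub>R v)) u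
      - frechet_derivative f (at (x + \<theta> *\<^sub>R u + 0 *\<^sub>R v)) u = (h - 0) *
     frechet_derivative (\<lambda>y. frechet_derivative f (at y) u) (at (x + \<theta> *\<^sub>R u + \<tau> *\<^sub>R v)) v"
  proof (rule MVT2[OF h(1)])
    fix t assume t: "0 \<le> t" "t \<le> h"
    have y: "x + \<theta> *\<^sub>R u + t *\<^sub>R v \<in> ball x r"
      using t \<theta> by (intro inb) auto
    have "((\<lambda>t. frechet_derivative f (at (x + \<theta> *\<^sub>R u + t *\<^sub>R v)) u) has_derivative
      (\<lambda>e. frechet_derivative (\<lambda>y. frechet_derivative f (at y) u) (at (x + \<theta> *\<^sub>R u + t *\<^sub>R v)) (e *\<^sub>R v))) (at t)"
      by (rule has_derivative_compose[where f = "\<lambda>t. x + \<theta> *\<^sub>R u + t *\<^sub>R v"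
            and g = "\<lambda>y. frechet_derivative f (at y) u", OF _ fdd[OF y]])
        (auto intro!: derivative_eq_intros)
    then show "((\<lambda>t. frechet_derivative f (at (x + \<theta> *\<^sub>R u + t *\<^sub>R v)) u) has_real_derivative
      frechet_derivative (\<lambda>y. frechet_derivative f (at y) u) (at (x + \<theta> *\<^sub>R u + t *\<^sub>R v)) v) (at t)"
      using linear_cmul[OF has_derivative_linear[OF fdd[OF y]]]
      by (simp add: has_field_derivative_def mult.commute[of _ "_ v"])
  qed
  then obtain \<tau> where \<tau>: "0 < \<tau>" "\<tau> < h" and eq2: "frechet_derivative f (at (x + \<theta> *\<^sub>R u + h *\<^sub>R v)) u
      - frechet_derivative f (at (x + \<theta> *\<^sub>R u)) u = h *
     frechet_derivative (\<lambda>y. frechet_derivative f (at y) u) (at (x + \<theta> *\<^sub>R u + \<tau> *\<^sub>R v)) v"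
    by auto
  have "x + \<theta> *\<^sub>R u + \<tau> *\<^sub>R v \<in> cball x (h * (norm u + norm v))"
    using near[of \<theta> \<tau>] \<theta> \<tau> norm_minus_cancel[of "\<theta> *\<^sub>R u + \<tau> *\<^sub>R v"]
    by (simp add: dist_norm add.assoc)
  moreover have "f (x + h *\<^sub>R u + h *\<^sub>R v) - f (x + h *\<^sub>R u) - f (x + h *\<^sub>R v) + f x = \<phi> h - \<phi> 0"
    by (simp add: \<phi>_def)
  ultimately show ?thesis
    using eq1 eq2 by (intro bexI[of _ "x + \<theta> *\<^sub>R u + \<tau> *\<^sub>R v"]) (simp_all add: mult.assoc)
qed

text \<open>Both mixed derivatives at \<open>x\<close> are limits of the same second difference
  divided by \<open>h * h\<close>; their continuity then excludes different values.\<close>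

lemma second_derivative_commute_real:
  fixes f :: "'a::real_normed_vector \<Rightarrow> real"
  assumes S: "open S" "x \<in> S" and f: "Ck_on 2 f S"
  shows "frechet_derivative (\<lambda>y. frechet_derivative f (at y) u) (at x) v
       = frechet_derivative (\<lambda>y. frechet_derivative f (at y) v) (at x) u"
    (is "?p x = ?q x")
proof (rule ccontr)
  assume ne: "?p x \<noteq> ?q x"
  \<comment> \<open>Half the gap: a value within \<open>e\<close> of \<open>?p x\<close> cannot
    equal a value within \<open>e\<close> of \<open>?q x\<close>.\<close>
  define e where "e = \<bar>?p x - ?q x\<bar> / 2"
  have e: "e > 0" using ne by (simp add: e_def)
  obtain r where r: "r > 0" "ball x r \<subseteq> S"
    using S open_contains_ball by blast
  have "continuous_on S ?p" "continuous_on S ?q"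
    using f unfolding numeral_2_eq_2 by simp_all
  then have "isCont ?p x" "isCont ?q x"
    using S by (simp_all add: continuous_on_eq_continuous_at)
  then have pq: "\<exists>d>0. \<forall>y. dist y x < d \<longrightarrow> dist (?p y) (?p x) < e"
    "\<exists>d>0. \<forall>y. dist y x < d \<longrightarrow> dist (?q y) (?q x) < e"
    using e by (auto simp only: continuous_at_eps_delta)
  obtain d1 where d1: "d1 > 0" and p: "\<And>y. dist y x < d1 \<Longrightarrow> dist (?p y) (?p x) < e"
    using pq(1) by blast
  obtain d2 where d2: "d2 > 0" and q: "\<And>y. dist y x < d2 \<Longrightarrow> dist (?q y) (?q x) < e"
    using pq(2) by blast
  define R where "R = min r (min d1 d2)"
  \<comment> \<open>The summand \<open>1\<close> keeps the divisor positive when \<open>u\<close>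
    and \<open>v\<close> are both zero; halving \<open>R\<close> puts the closed ball inside the
    open ball of radius \<open>R\<close>.\<close>
  define h where "h = R / 2 / (norm u + norm v + 1)"
  have R: "R > 0" using r d1 d2 by (simp add: R_def)
  have n: "norm u + norm v + 1 > 0" by (smt (verit) norm_ge_zero)
  have h: "h > 0" using R n by (simp add: h_def)
  have "h * (norm u + norm v) \<le> h * (norm u + norm v + 1)"
    using h by (simp add: mult_left_mono)
  also have "\<dots> = R / 2" using n unfolding h_def by (metis less_irrefl nonzero_eq_divide_eq)
  also have "\<dots> < R" using R by simp
  finally have hR: "h * (norm u + norm v) < R" .
  obtain y where y: "y \<in> cball x (h * (norm u + norm v))"
    and yeq: "f (x + h *\<^sub>R u + h *\<^sub>R v) - f (x + h *\<^sub>R u) - f (x + h *\<^sub>R v) + f x = h * h * ?p y"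
    using second_difference_mvt[OF r(2) f h, of u v] hR by (auto simp: R_def)
  obtain z where z: "z \<in> cball x (h * (norm v + norm u))"
    and zeq: "f (x + h *\<^sub>R v + h *\<^sub>R u) - f (x + h *\<^sub>R v) - f (x + h *\<^sub>R u) + f x = h * h * ?q z"
    using second_difference_mvt[OF r(2) f h, of v u] hR by (auto simp: R_def add.commute)
  have "?p y = ?q z"
    using yeq zeq h by (simp add: algebra_simps)
  moreover have "dist (?p y) (?p x) < e" "dist (?q z) (?q x) < e"
    using p[of y] q[of z] y z hR by (auto simp: R_def dist_commute add.commute)
  ultimately have "\<bar>?p x - ?q x\<bar> < 2 * e"
    unfolding dist_real_def by linarith
  then show False
    by (simp add: e_def)
qed

text \<open>Pairing with a fixed vector reduces this to the real case. Taking as that vector the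
  difference \<open>w\<close> of the two sides gives \<open>w \<bullet> w = 0\<close>.\<close>

lemma second_derivative_commute:
  fixes f :: "'a::real_normed_vector \<Rightarrow> 'b::real_inner"
  assumes S: "open S" "x \<in> S" and f: "Ck_on 2 f S"
  shows "frechet_derivative (\<lambda>y. frechet_derivative f (at y) u) (at x) v
       = frechet_derivative (\<lambda>y. frechet_derivative f (at y) v) (at x) u"
    (is "?l = ?r")
proof -
  define w where "w = ?l - ?r"
  have bl: "bounded_linear (\<lambda>y::'b. y \<bullet> w)"
    by (rule bounded_linear_inner_left)
  have d: "frechet_derivative (\<lambda>y. h y \<bullet> w) (at y) v = frechet_derivative h (at y) v \<bullet> w"
    if "h differentiable (at y)" for h :: "'a \<Rightarrow> 'b" and y v
    using frechet_derivative_at[OF bounded_linear.has_derivative[OF bl]] that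
    by (metis frechet_derivative_works)
  have f1: "f differentiable (at y)" and
    f2: "(\<lambda>y. frechet_derivative f (at y) v) differentiable (at y)" if "y \<in> S" for y v
    using f that unfolding numeral_2_eq_2 by simp_all
  have "frechet_derivative (\<lambda>y. frechet_derivative (\<lambda>y. f y \<bullet> w) (at y) u) (at x) v
      = frechet_derivative (\<lambda>y. frechet_derivative f (at y) u) (at x) v \<bullet> w" for u v
  proof -
    have "(\<lambda>y. frechet_derivative f (at y) u \<bullet> w) differentiable (at x)"
      using f2[OF S(2), of u] bounded_linear.has_derivative[OF bl]
      unfolding differentiable_def by blast
    then have "frechet_derivative (\<lambda>y. frechet_derivative f (at y) u \<bullet> w) (at x)
      = frechet_derivative (\<lambda>y. frechet_derivative (\<lambda>y. f y \<bullet> w) (at y) u) (at x)"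
      by (rule frechet_derivative_transform_within_open[OF _ S]) (simp add: d f1)
    then show ?thesis
      using d[OF f2[OF S(2)]] by metis
  qed
  then have "?l \<bullet> w = ?r \<bullet> w"
    using second_derivative_commute_real[OF S Ck_on_bounded_linear[OF bl S(1) f]] by metis
  then have "w \<bullet> w = 0"
    by (simp add: w_def inner_diff_left)
  then show ?thesis
    by (simp add: w_def)
qed

section \<open>Wirtinger derivatives\<close>

text \<open>A common form of \<open>d_z\<close>, \<open>d_eta\<close> (both with \<open>c = -\<i>\<close>) and \<open>d_etabar\<close> (with \<open>c = \<i>\<close>).\<close>
definition wirt :: "complex \<Rightarrow> 'a::real_normed_vector \<Rightarrow> 'a \<Rightarrow> ('a \<Rightarrow> complex) \<Rightarrow> 'a \<Rightarrow> complex" where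
  "wirt c u v h p = (frechet_derivative h (at p) u + c * frechet_derivative h (at p) v) / 2"

lemma d_z_eq_wirt: "d_z k = wirt (-\<i>) (axis k 1, 0) (axis k \<i>, 0)"
  by (simp add: fun_eq_iff d_z_def wirt_def)

lemma d_eta_eq_wirt: "d_eta k = wirt (-\<i>) (0, axis k 1) (0, axis k \<i>)"
  by (simp add: fun_eq_iff d_eta_def wirt_def)

lemma d_etabar_eq_wirt: "d_etabar k = wirt \<i> (0, axis k 1) (0, axis k \<i>)"
  by (simp add: fun_eq_iff d_etabar_def wirt_def)

lemmas wirtinger_eqs = d_z_eq_wirt d_eta_eq_wirt d_etabar_eq_wirt

lemma wirt_cong:
  assumes "open S" "p \<in> S" "\<And>x. x \<in> S \<Longrightarrow> f x = g x" "f differentiable (at p)"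
  shows "wirt c u v f p = wirt c u v g p"
  unfolding wirt_def using frechet_derivative_transform_within_open[OF assms(4,1,2,3)] by simp

lemma wirt_const [simp]: "wirt c u v (\<lambda>x. a) p = 0"
  by (simp add: wirt_def)

lemma wirt_bounded_linear:
  assumes "bounded_linear h"
  shows "wirt c u v h p = (h u + c * h v) / 2"
  unfolding wirt_def
  using frechet_derivative_at[OF bounded_linear_imp_has_derivative[OF assms]] by metis

lemma wirt_add:
  assumes "f differentiable (at p)" "g differentiable (at p)"
  shows "wirt c u v (\<lambda>x. f x + g x) p = wirt c u v f p + wirt c u v g p"
proof -
  have "((\<lambda>x. f x + g x) has_derivative
      (\<lambda>v. frechet_derivative f (at p) v + frechet_derivative g (at p) v)) (at p)"
    using assms by (intro has_derivative_add) (simp_all flip: frechet_derivative_works)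
  from frechet_derivative_at[OF this, symmetric] show ?thesis
    by (simp add: wirt_def algebra_simps add_divide_distrib)
qed

lemma wirt_mult:
  assumes "f differentiable (at p)" "g differentiable (at p)"
  shows "wirt c u v (\<lambda>x. f x * g x) p = wirt c u v f p * g p + f p * wirt c u v g p"
proof -
  have "((\<lambda>x. f x * g x) has_derivative
      (\<lambda>v. f p * frechet_derivative g (at p) v + frechet_derivative f (at p) v * g p)) (at p)"
    using assms by (intro has_derivative_mult) (simp_all flip: frechet_derivative_works)
  from frechet_derivative_at[OF this, symmetric] show ?thesis
    by (simp add: wirt_def algebra_simps add_divide_distrib)
qed

lemma wirt_sum:
  assumes "finite I" "\<And>i. i \<in> I \<Longrightarrow> f i differentiable (at p)"
  shows "wirt c u v (\<lambda>x. \<Sum>i\<in>I. f i x) p = (\<Sum>i\<in>I. wirt c u v (f i) p)"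
  using assms by (induction I) (simp_all add: wirt_add differentiable_sum)

lemma smooth_on_wirt: "open S \<Longrightarrow> smooth_on f S \<Longrightarrow> smooth_on (wirt c u v f) S"
  unfolding wirt_def[abs_def]
  by (intro smooth_on_divide smooth_on_add smooth_on_mult smooth_on_frechet_derivative) simp_all

text \<open>Each side is the same combination of four real second derivatives, up to the order of
  differentiation.\<close>

lemma wirt_commute:
  assumes S: "open S" "p \<in> S" and f: "smooth_on f S"
  shows "wirt a u v (wirt b s t f) p = wirt b s t (wirt a u v f) p"
proof -
  have expand: "frechet_derivative (wirt c u v f) (at p) w
      = (frechet_derivative (\<lambda>x. frechet_derivative f (at x) u) (at p) w
       + c * frechet_derivative (\<lambda>x. frechet_derivative f (at x) v) (at p) w) / 2" for c u v w
  proof -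
    have "((\<lambda>x. frechet_derivative f (at x) u) has_derivative
        frechet_derivative (\<lambda>x. frechet_derivative f (at x) u) (at p)) (at p)" for u
      using smooth_on_differentiable[OF smooth_on_frechet_derivative[OF f] S(2)]
      by (simp flip: frechet_derivative_works)
    then have "(wirt c u v f has_derivative
      (\<lambda>w. (frechet_derivative (\<lambda>x. frechet_derivative f (at x) u) (at p) w
       + c * frechet_derivative (\<lambda>x. frechet_derivative f (at x) v) (at p) w) / 2)) (at p)"
      unfolding wirt_def[abs_def] by (auto intro!: derivative_eq_intros)
    from frechet_derivative_at[OF this, symmetric] show ?thesis by simp
  qed
  have "Ck_on 2 f S"
    using f by (simp add: smooth_on_def)
  note sym = second_derivative_commute[OF S this]
  show ?thesis
    by (simp add: wirt_def[of a u v] wirt_def[of b s t] expand sym[of s] sym[of t])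
       (simp add: field_simps)
qed

lemma wirtinger_mult:
  assumes "g differentiable (at p)" "h differentiable (at p)"
  shows "d_z k (\<lambda>x. g x * h x) p = d_z k g p * h p + g p * d_z k h p"
    and "d_eta k (\<lambda>x. g x * h x) p = d_eta k g p * h p + g p * d_eta k h p"
    and "d_etabar k (\<lambda>x. g x * h x) p = d_etabar k g p * h p + g p * d_etabar k h p"
  using assms by (simp_all add: wirtinger_eqs wirt_mult)

lemma wirtinger_add:
  assumes "g differentiable (at p)" "h differentiable (at p)"
  shows "d_z k (\<lambda>x. g x + h x) p = d_z k g p + d_z k h p"
    and "d_eta k (\<lambda>x. g x + h x) p = d_eta k g p + d_eta k h p"
    and "d_etabar k (\<lambda>x. g x + h x) p = d_etabar k g p + d_etabar k h p"
  using assms by (simp_all add: wirtinger_eqs wirt_add)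

lemma wirtinger_const [simp]: "d_z k (\<lambda>x. a) p = 0" "d_eta k (\<lambda>x. a) p = 0" "d_etabar k (\<lambda>x. a) p = 0"
  by (simp_all add: wirtinger_eqs)

lemma wirtinger_sum:
  assumes "finite I" "\<And>i. i \<in> I \<Longrightarrow> h i differentiable (at p)"
  shows "d_z k (\<lambda>x. \<Sum>i\<in>I. h i x) p = (\<Sum>i\<in>I. d_z k (h i) p)"
    and "d_eta k (\<lambda>x. \<Sum>i\<in>I. h i x) p = (\<Sum>i\<in>I. d_eta k (h i) p)"
    and "d_etabar k (\<lambda>x. \<Sum>i\<in>I. h i x) p = (\<Sum>i\<in>I. d_etabar k (h i) p)"
  using assms by (simp_all add: wirtinger_eqs wirt_sum)

lemma wirtinger_cong:
  assumes "open S" "p \<in> S" "\<And>x. x \<in> S \<Longrightarrow> g x = h x" "g differentiable (at p)"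
  shows "d_z k g p = d_z k h p" and "d_eta k g p = d_eta k h p" and "d_etabar k g p = d_etabar k h p"
  using wirt_cong[OF assms] by (simp_all add: wirtinger_eqs)

lemma smooth_on_wirtinger:
  assumes "open S" "smooth_on h S"
  shows "smooth_on (d_z k h) S" and "smooth_on (d_eta k h) S" and "smooth_on (d_etabar k h) S"
  using smooth_on_wirt[OF assms] by (simp_all add: wirtinger_eqs)

lemma wirtinger_commute:
  assumes "open S" "p \<in> S" "smooth_on h S"
  shows "d_eta j (d_eta k h) p = d_eta k (d_eta j h) p"
    and "d_etabar j (d_eta k h) p = d_eta k (d_etabar j h) p"
    and "d_z j (d_eta k h) p = d_eta k (d_z j h) p"
  using wirt_commute[OF assms] by (simp_all add: wirtinger_eqs)

lemma bounded_linear_eta: "bounded_linear (\<lambda>p::'n::finite pt. snd p $ i)"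
  by (rule bounded_linear_compose[OF bounded_linear_vec_nth bounded_linear_snd])

lemma bounded_linear_cnj_eta: "bounded_linear (\<lambda>p::'n::finite pt. cnj (snd p $ i))"
  by (rule bounded_linear_compose[OF bounded_linear_cnj bounded_linear_eta])

lemma wirtinger_eta [simp]:
  "d_z k (\<lambda>p. snd p $ i) p = 0"
  "d_eta k (\<lambda>p. snd p $ i) p = (if i = k then 1 else 0)"
  "d_etabar k (\<lambda>p. snd p $ i) p = 0"
  "d_z k (\<lambda>p. cnj (snd p $ i)) p = 0"
  "d_eta k (\<lambda>p. cnj (snd p $ i)) p = 0"
  "d_etabar k (\<lambda>p. cnj (snd p $ i)) p = (if i = k then 1 else 0)"
  by (simp_all add: wirtinger_eqs wirt_bounded_linear bounded_linear_eta bounded_linear_cnj_eta axis_def)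

text \<open>\<open>D\<close> is only real linear, so the fibre is expanded in its real basis of the
  vectors \<open>axis k 1\<close> and \<open>axis k \<i>\<close>.\<close>

lemma linear_eta_expand:
  fixes D :: "'n::finite pt \<Rightarrow> complex"
  assumes "linear D"
  shows "D (0, \<eta>) = (\<Sum>k\<in>UNIV. Re (\<eta> $ k) * D (0, axis k 1) + Im (\<eta> $ k) * D (0, axis k \<i>))"
proof -
  have "\<eta> = (\<Sum>k\<in>UNIV. Re (\<eta> $ k) *\<^sub>R axis k 1 + Im (\<eta> $ k) *\<^sub>R axis k \<i>)"
    by (simp add: vec_eq_iff axis_def sum.distrib if_distrib complex_eq_iff cong: if_cong)
  then have "(0, \<eta>) = (\<Sum>k\<in>UNIV. Re (\<eta> $ k) *\<^sub>R (0::complex^'n, axis k 1) + Im (\<eta> $ k) *\<^sub>R (0, axis k \<i>))"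
    by (simp add: prod_eq_iff fst_sum snd_sum)
  also have "D \<dots> = (\<Sum>k\<in>UNIV. Re (\<eta> $ k) * D (0, axis k 1) + Im (\<eta> $ k) * D (0, axis k \<i>))"
    using assms by (simp only: linear_sum linear_add linear_cmul scaleR_conv_of_real)
  finally show ?thesis .
qed

text \<open>The right sides are the complex linear and the antilinear part of the real differential
  \<open>D\<close> in the fibre direction \<eta>; the Wirtinger derivatives are the components of
  these two parts.\<close>

lemma euler_wirtinger:
  assumes "h differentiable (at (z, \<eta>))"
  defines "D \<equiv> frechet_derivative h (at (z, \<eta>))"
  shows "(\<Sum>k\<in>UNIV. \<eta> $ k * d_eta k h (z, \<eta>)) = (D (0, \<eta>) - \<i> * D (0, \<i> *s \<eta>)) / 2"
    and "(\<Sum>k\<in>UNIV. cnj (\<eta> $ k) * d_etabar k h (z, \<eta>)) = (D (0, \<eta>) + \<i> * D (0, \<i> *s \<eta>)) / 2"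
proof -
  have "linear D"
    unfolding D_def using assms(1) by (rule linear_frechet_derivative)
  note e = linear_eta_expand[OF this]
  have \<eta>: "\<eta> $ k = Re (\<eta> $ k) + \<i> * Im (\<eta> $ k)" "cnj (\<eta> $ k) = Re (\<eta> $ k) - \<i> * Im (\<eta> $ k)" for k
    by (simp_all add: complex_eq_iff)
  have i: "\<i> * (\<i> * x) = - x" for x by (simp flip: mult.assoc)
  show "(\<Sum>k\<in>UNIV. \<eta> $ k * d_eta k h (z, \<eta>)) = (D (0, \<eta>) - \<i> * D (0, \<i> *s \<eta>)) / 2"
    unfolding e[of \<eta>] e[of "\<i> *s \<eta>"] d_eta_def D_def[symmetric]
    by (subst \<eta>(1)) (simp add: sum_distrib_left sum_divide_distrib algebra_simps i
        flip: sum_subtractf sum.distrib)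
  show "(\<Sum>k\<in>UNIV. cnj (\<eta> $ k) * d_etabar k h (z, \<eta>)) = (D (0, \<eta>) + \<i> * D (0, \<i> *s \<eta>)) / 2"
    unfolding e[of \<eta>] e[of "\<i> *s \<eta>"] d_etabar_def D_def[symmetric]
    by (subst \<eta>(2)) (simp add: sum_distrib_left sum_divide_distrib algebra_simps i
        flip: sum_subtractf sum.distrib)
qed

section \<open>Positive definite matrices, inverses and determinants\<close>

lemma pos_def_hermitian_invertible:
  fixes A :: "complex^'n^'n::finite"
  assumes "pos_def_hermitian A"
  shows "invertible A"
proof -
  have "w = 0" if w: "A *v w = 0" for w
  proof (rule ccontr)
    assume "w \<noteq> 0"
    \<comment> \<open>The form conjugates the factor belonging to the column index, so the kernel
      vector has to be inserted as its conjugate for \<open>A *v w\<close> to appear.\<close>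
    then have "(\<chi> i. cnj (w $ i)) \<noteq> 0" by (auto simp: vec_eq_iff)
    then have "0 < Re (\<Sum>i\<in>UNIV. \<Sum>j\<in>UNIV. A $ i $ j * cnj (w $ i) * w $ j)"
      using assms[unfolded pos_def_hermitian_def, THEN conjunct2, rule_format,
          of "\<chi> i. cnj (w $ i)"] by simp
    also have "(\<Sum>i\<in>UNIV. \<Sum>j\<in>UNIV. A $ i $ j * cnj (w $ i) * w $ j)
        = (\<Sum>i\<in>UNIV. cnj (w $ i) * (A *v w) $ i)"
      by (simp add: matrix_vector_mult_def sum_distrib_left mult_ac)
    also have "\<dots> = 0" by (simp add: w)
    finally show False by simp
  qed
  then show ?thesis
    using invertible_left_inverse matrix_left_invertible_ker by blast
qed

lemma invertible_matrix_inv: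
  assumes "invertible A"
  shows "A ** matrix_inv A = mat 1" and "matrix_inv A ** A = mat 1"
  using someI_ex[OF assms[unfolded invertible_def]] unfolding matrix_inv_def by auto

text \<open>Column \<open>i\<close> of the inverse solves \<open>A *v x = axis i 1\<close>. Cramer's
  rule makes its entries quotients of determinants, from which the smoothness of \<open>gup\<close>
  follows.\<close>

lemma matrix_inv_cramer:
  fixes A :: "'a::field^'n^'n::finite"
  assumes "invertible A"
  shows "matrix_inv A $ m $ i = det (\<chi> r s. if s = m then (if r = i then 1 else 0) else A $ r $ s) / det A"
proof -
  have "det A \<noteq> 0" using assms by (simp add: invertible_det_nz)
  moreover have "A *v (matrix_inv A *v axis i 1) = axis i 1"
    by (simp add: matrix_vector_mul_assoc invertible_matrix_inv(1)[OF assms])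
  ultimately have "matrix_inv A *v axis i 1
      = (\<chi> k. det (\<chi> r s. if s = k then axis i 1 $ r else A $ r $ s) / det A)"
    using cramer by blast
  from arg_cong[OF this, of "\<lambda>v. v $ m"] show ?thesis
    by (simp add: matrix_vector_mult_def axis_def if_distrib cong: if_cong)
qed

lemma smooth_on_det:
  fixes A :: "'a::real_normed_vector \<Rightarrow> 'b::real_normed_field^'n^'n::finite"
  assumes "open S" "\<And>i j. smooth_on (\<lambda>x. A x $ i $ j) S"
  shows "smooth_on (\<lambda>x. det (A x)) S"
  unfolding det_def using assms by (intro smooth_on_sum smooth_on_mult smooth_on_prod smooth_on_const)

section \<open>Complex Finsler functions in a chart\<close>

text \<open>The Finsler function in one bundle chart, with all conditions in coordinates, so that
  the geometry is free of the manifold; \<open>finsler_chart_local_rep\<close> supplies the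
  instances.\<close>

locale finsler_chart =
  fixes U :: "(complex^'n::finite) set" and f :: "'n pt \<Rightarrow> real"
  assumes open_U: "open U"
    and smooth_f_sq: "smooth_on (\<lambda>p. (f p)\<^sup>2) (U \<times> (- {0}))"
    and pos: "z \<in> U \<Longrightarrow> \<eta> \<noteq> 0 \<Longrightarrow> 0 < f (z, \<eta>)"
    and homogeneous: "z \<in> U \<Longrightarrow> f (z, a *s \<eta>) = cmod a * f (z, \<eta>)"
    and pos_def: "p \<in> U \<times> (- {0}) \<Longrightarrow> pos_def_hermitian (gmat f p)"
begin

abbreviation S :: "'n pt set" where "S \<equiv> U \<times> (- {0})"

definition L :: "'n pt \<Rightarrow> complex" where "L p = of_real ((f p)\<^sup>2)"

lemma open_S: "open S"
  using open_U by (intro open_Times) auto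

lemma gdown_eq: "gdown f i j = d_eta i (d_etabar j L)"
  by (simp add: gdown_def L_def[abs_def])

lemma smooth_L: "smooth_on L S"
  unfolding L_def[abs_def]
  by (rule smooth_on_bounded_linear_compose[OF bounded_linear_of_real open_S smooth_f_sq])

lemma smooth_eta: "smooth_on (\<lambda>p. snd p $ i) S" "smooth_on (\<lambda>p. cnj (snd p $ i)) S"
  by (rule smooth_on_bounded_linear, rule bounded_linear_eta bounded_linear_cnj_eta)+

lemma smooth_gdown: "smooth_on (gdown f i j) S"
  unfolding gdown_eq by (intro smooth_on_wirtinger open_S smooth_L)

lemma invertible_gmat: "p \<in> S \<Longrightarrow> invertible (gmat f p)"
  using pos_def pos_def_hermitian_invertible by blast

lemma gup_inverse:
  assumes "p \<in> S"
  shows "(\<Sum>m\<in>UNIV. gdown f j m p * gup f m i p) = (if j = i then 1 else 0)"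
    and "(\<Sum>i\<in>UNIV. gup f l i p * gdown f i m p) = (if l = m then 1 else 0)"
  using arg_cong[OF invertible_matrix_inv(1)[OF invertible_gmat[OF assms]], of "\<lambda>A. A $ j $ i"]
    arg_cong[OF invertible_matrix_inv(2)[OF invertible_gmat[OF assms]], of "\<lambda>A. A $ l $ m"]
  by (simp_all add: matrix_matrix_mult_def gup_def gmat_def mat_def)

lemma lower_gup:
  assumes "p \<in> S"
  shows "(\<Sum>i\<in>UNIV. gdown f i m p * (\<Sum>l\<in>UNIV. gup f l i p * X l)) = X m"
proof -
  have "(\<Sum>i\<in>UNIV. gdown f i m p * (\<Sum>l\<in>UNIV. gup f l i p * X l))
      = (\<Sum>l\<in>UNIV. \<Sum>i\<in>UNIV. gup f l i p * gdown f i m p * X l)"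
    by (subst sum.swap) (simp add: sum_distrib_left mult_ac)
  also have "\<dots> = X m"
    using assms by (simp add: gup_inverse if_distrib[of "\<lambda>x. x * _"] flip: sum_distrib_right cong: if_cong)
  finally show ?thesis .
qed

lemma raise_gdown:
  assumes "p \<in> S"
  shows "(\<Sum>m\<in>UNIV. gup f m j p * (\<Sum>i\<in>UNIV. gdown f i m p * X i)) = X j"
proof -
  have "(\<Sum>m\<in>UNIV. gup f m j p * (\<Sum>i\<in>UNIV. gdown f i m p * X i))
      = (\<Sum>i\<in>UNIV. \<Sum>m\<in>UNIV. gdown f i m p * gup f m j p * X i)"
    by (subst sum.swap) (simp add: sum_distrib_left mult_ac)
  also have "\<dots> = X j"
    using assms by (simp add: gup_inverse if_distrib[of "\<lambda>x. x * _"] flip: sum_distrib_right cong: if_cong)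
  finally show ?thesis .
qed

text \<open>The metric is nondegenerate, so identities with an upper index may be compared after
  lowering it. This avoids computing derivatives of the inverse matrix \<open>gup\<close>.\<close>

lemma gdown_cancel:
  assumes "p \<in> S" "\<And>m. (\<Sum>i\<in>UNIV. gdown f i m p * X i) = (\<Sum>i\<in>UNIV. gdown f i m p * Y i)"
  shows "X j = Y j"
  using raise_gdown[OF assms(1), of j X] raise_gdown[OF assms(1), of j Y] assms(2) by simp

lemma smooth_gup: "smooth_on (gup f m i) S"
proof -
  have "smooth_on (\<lambda>p. det (\<chi> r s. if s = m then (if r = i then 1 else 0) else gmat f p $ r $ s)
      / det (gmat f p)) S"
  proof (intro smooth_on_divide smooth_on_det open_S)
    show "det (gmat f p) \<noteq> 0" if "p \<in> S" for p
      using invertible_gmat[OF that] invertible_det_nz by blast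
    show "smooth_on (\<lambda>p. gmat f p $ r $ s) S" for r s
      by (simp add: gmat_def smooth_gdown)
    then show "smooth_on (\<lambda>p. (\<chi> r s. if s = m then (if r = i then 1 else 0)
        else gmat f p $ r $ s) $ r $ s) S" for r s
      by (cases "s = m") simp_all
  qed
  then show ?thesis
    by (rule smooth_on_cong[OF open_S, THEN iffD1, rotated])
       (simp add: gup_def matrix_inv_cramer[OF invertible_gmat])
qed

lemmas smooth_intros = open_S smooth_on_wirtinger smooth_on_sum smooth_on_mult smooth_on_add smooth_L
  smooth_eta smooth_gdown smooth_gup

lemma smooth_N_cf: "smooth_on (N_cf f k j) S"
  unfolding N_cf_def[abs_def] by (intro smooth_intros)

lemma smooth_spray: "smooth_on (spray f i) S"
  unfolding spray_def[abs_def]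
  by (intro smooth_on_divide smooth_intros smooth_N_cf smooth_on_const) simp

lemma smooth_N_can: "smooth_on (N_can f i j) S"
  unfolding N_can_def by (intro smooth_intros smooth_spray)

lemma smooth_C_cf: "smooth_on (C_cf f i j k) S"
  unfolding C_cf_def[abs_def] by (intro smooth_intros)

lemmas smooth_differentiable = smooth_on_differentiable[where S = S]

section \<open>Homogeneity and Euler identities\<close>

lemma L_scale: "z \<in> U \<Longrightarrow> L (z, a *s \<eta>) = of_real ((cmod a)\<^sup>2) * L (z, \<eta>)"
  by (simp add: L_def homogeneous power_mult_distrib)

text \<open>Along the line \<open>\<eta> + t *\<^sub>R (c *s \<eta>)\<close>, homogeneity makes
  \<open>L\<close> its value at \<eta> times the polynomial
  \<open>(cmod (1 + t * c))\<^sup>2\<close>, whose linear coefficient is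
  \<open>2 * Re c\<close>.\<close>

lemma frechet_derivative_L_radial:
  assumes "(z, \<eta>) \<in> S"
  shows "frechet_derivative L (at (z, \<eta>)) (0, c *s \<eta>) = of_real (2 * Re c) * L (z, \<eta>)"
proof -
  define D where "D = frechet_derivative L (at (z, \<eta>))"
  have D: "(L has_derivative D) (at (z, \<eta>))"
    unfolding D_def using smooth_differentiable[OF smooth_L assms] by (simp flip: frechet_derivative_works)
  have "((\<lambda>t::real. L (z, \<eta> + t *\<^sub>R (c *s \<eta>))) has_derivative (\<lambda>t. D (0, t *\<^sub>R (c *s \<eta>)))) (at 0)"
    by (rule has_derivative_compose[where f = "\<lambda>t::real. (z, \<eta> + t *\<^sub>R (c *s \<eta>))" and g = L])
      (auto intro!: derivative_eq_intros simp: D)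
  moreover have "L (z, \<eta> + t *\<^sub>R (c *s \<eta>)) = of_real (1 + 2 * Re c * t + (cmod c)\<^sup>2 * t\<^sup>2) * L (z, \<eta>)" for t
  proof -
    have v: "\<eta> + t *\<^sub>R (c *s \<eta>) = (1 + complex_of_real t * c) *s \<eta>"
      by (simp add: vec_eq_iff algebra_simps scaleR_conv_of_real[where 'a = complex])
    have c: "(cmod (1 + of_real t * c))\<^sup>2 = 1 + 2 * Re c * t + (cmod c)\<^sup>2 * t\<^sup>2"
      unfolding cmod_power2 by (simp add: algebra_simps power2_eq_square)
    show ?thesis
      using assms by (simp only: v L_scale c mem_Times_iff fst_conv)
  qed
  ultimately have "((\<lambda>t::real. of_real (1 + 2 * Re c * t + (cmod c)\<^sup>2 * t\<^sup>2) * L (z, \<eta>))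
      has_derivative (\<lambda>t. D (0, t *\<^sub>R (c *s \<eta>)))) (at 0)"
    by simp
  moreover have "((\<lambda>t::real. of_real (1 + 2 * Re c * t + (cmod c)\<^sup>2 * t\<^sup>2) * L (z, \<eta>))
      has_derivative (\<lambda>t. of_real (2 * Re c * t) * L (z, \<eta>))) (at 0)"
    by (auto intro!: derivative_eq_intros)
  ultimately have "(\<lambda>t. D (0, t *\<^sub>R (c *s \<eta>))) = (\<lambda>t. of_real (2 * Re c * t) * L (z, \<eta>))"
    by (rule has_derivative_unique)
  from fun_cong[OF this, of 1] show ?thesis
    by (simp add: D_def)
qed

text \<open>The real differential of \<open>L\<close> is \<open>2 * L\<close> along \<eta> and
  \<open>0\<close> along \<open>\<i> *s \<eta>\<close>, so its linear and its antilinear part at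
  \<eta> are both \<open>L\<close>.\<close>

lemma euler_L:
  assumes "p \<in> S"
  shows "(\<Sum>k\<in>UNIV. snd p $ k * d_eta k L p) = L p"
    and "(\<Sum>k\<in>UNIV. cnj (snd p $ k) * d_etabar k L p) = L p"
proof -
  obtain z \<eta> where p: "p = (z, \<eta>)" by (cases p)
  note z = assms[unfolded p]
  show "(\<Sum>k\<in>UNIV. snd p $ k * d_eta k L p) = L p"
    "(\<Sum>k\<in>UNIV. cnj (snd p $ k) * d_etabar k L p) = L p"
    using euler_wirtinger[OF smooth_differentiable[OF smooth_L z]]
      frechet_derivative_L_radial[OF z, of 1] frechet_derivative_L_radial[OF z, of \<i>]
    by (simp_all add: p)
qed

text \<open>Apply \<open>d_etabar m\<close> to the first Euler identity; the coordinates \<eta> are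
  holomorphic, so only the other factor is differentiated.\<close>

lemma eta_gdown:
  assumes p: "p \<in> S"
  shows "(\<Sum>k\<in>UNIV. snd p $ k * gdown f k m p) = d_etabar m L p"
proof -
  have "d_etabar m L p = d_etabar m (\<lambda>p. \<Sum>k\<in>UNIV. snd p $ k * d_eta k L p) p"
    by (rule wirtinger_cong(3)[OF open_S p])
      (simp_all add: euler_L smooth_differentiable[OF smooth_L p])
  also have "\<dots> = (\<Sum>k\<in>UNIV. snd p $ k * d_etabar m (d_eta k L) p)"
    by (subst wirtinger_sum wirtinger_mult, (intro finite smooth_differentiable[OF _ p] smooth_intros)+)+ simp
  finally show ?thesis
    by (simp add: gdown_eq wirtinger_commute(2)[OF open_S p smooth_L])
qed

lemma cnj_eta_gdown:
  assumes p: "p \<in> S"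
  shows "(\<Sum>m\<in>UNIV. gdown f k m p * cnj (snd p $ m)) = d_eta k L p"
proof -
  have "d_eta k L p = d_eta k (\<lambda>p. \<Sum>m\<in>UNIV. cnj (snd p $ m) * d_etabar m L p) p"
    by (rule wirtinger_cong(2)[OF open_S p])
      (simp_all add: euler_L smooth_differentiable[OF smooth_L p])
  also have "\<dots> = (\<Sum>m\<in>UNIV. cnj (snd p $ m) * d_eta k (d_etabar m L) p)"
    by (subst wirtinger_sum wirtinger_mult, (intro finite smooth_differentiable[OF _ p] smooth_intros)+)+ simp
  finally show ?thesis
    by (simp add: gdown_eq mult.commute)
qed

lemma gdown_eta_eta:
  assumes p: "p \<in> S"
  shows "(\<Sum>i\<in>UNIV. \<Sum>j\<in>UNIV. gdown f i j p * snd p $ i * cnj (snd p $ j)) = L p"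
proof -
  have "(\<Sum>i\<in>UNIV. \<Sum>j\<in>UNIV. gdown f i j p * snd p $ i * cnj (snd p $ j))
      = (\<Sum>i\<in>UNIV. snd p $ i * (\<Sum>j\<in>UNIV. gdown f i j p * cnj (snd p $ j)))"
    by (simp add: sum_distrib_left mult_ac)
  then show ?thesis
    using p by (simp add: cnj_eta_gdown euler_L)
qed

text \<open>Both are third derivatives of \<open>L\<close>. This is the source of the symmetry of
  \<open>C_cf\<close> in its lower indices.\<close>

lemma d_eta_gdown_commute:
  "p \<in> S \<Longrightarrow> d_eta k (gdown f j m) p = d_eta j (gdown f k m) p"
  unfolding gdown_eq by (rule wirtinger_commute[OF open_S]) (auto intro!: smooth_intros)

text \<open>Differentiate \<open>eta_gdown\<close> in \<eta>: the term in which the explicit \<eta>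
  is differentiated already equals the derivative of the right side, so the other term
  vanishes.\<close>

lemma eta_d_eta_gdown:
  assumes p: "p \<in> S"
  shows "(\<Sum>l\<in>UNIV. snd p $ l * d_eta j (gdown f l m) p) = 0"
proof -
  have "gdown f j m p = d_eta j (\<lambda>p. \<Sum>l\<in>UNIV. snd p $ l * gdown f l m p) p"
    unfolding gdown_eq[of j]
    by (rule wirtinger_cong(2)[OF open_S p])
      (simp_all add: eta_gdown smooth_differentiable[OF _ p] smooth_on_wirtinger smooth_L open_S)
  also have "\<dots> = (\<Sum>l\<in>UNIV. (if l = j then 1 else 0) * gdown f l m p + snd p $ l * d_eta j (gdown f l m) p)"
    by (subst wirtinger_sum wirtinger_mult, (intro finite smooth_differentiable[OF _ p] smooth_intros)+)+ simp
  finally show ?thesis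
    by (simp add: sum.distrib if_distrib[of "\<lambda>x. x * _"] cong: if_cong)
qed

text \<open>This is \<open>eta_d_eta_gdown\<close> differentiated in z; \<eta> does not depend on z,
  and the two derivatives of the metric commute.\<close>

lemma eta_d_z_d_eta_gdown:
  assumes p: "p \<in> S"
  shows "(\<Sum>l\<in>UNIV. snd p $ l * d_eta j (d_z r (gdown f l m)) p) = 0"
proof -
  have "0 = d_z r (\<lambda>p. \<Sum>l\<in>UNIV. snd p $ l * d_eta j (gdown f l m) p) p"
    by (subst wirtinger_cong(1)[OF open_S p, where h = "\<lambda>_. 0"])
      (simp_all only: eta_d_eta_gdown wirtinger_const, intro smooth_differentiable[OF _ p] smooth_intros finite)
  also have "\<dots> = (\<Sum>l\<in>UNIV. snd p $ l * d_z r (d_eta j (gdown f l m)) p)"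
    by (subst wirtinger_sum wirtinger_mult, (intro finite smooth_differentiable[OF _ p] smooth_intros)+)+ simp
  finally show ?thesis
    by (simp add: wirtinger_commute(3)[OF open_S p smooth_gdown])
qed

end

section \<open>The derivation \<open>bar0\<close>\<close>

lemma bar0_mult:
  assumes "g differentiable (at p)" "h differentiable (at p)"
  shows "bar0 f (\<lambda>x. g x * h x) p = bar0 f g p * h p + g p * bar0 f h p"
  unfolding bar0_def delta_cf_def
  by (simp add: wirtinger_mult[OF assms] algebra_simps sum.distrib sum_subtractf sum_distrib_left)

lemma bar0_add:
  assumes "g differentiable (at p)" "h differentiable (at p)"
  shows "bar0 f (\<lambda>x. g x + h x) p = bar0 f g p + bar0 f h p"
  unfolding bar0_def delta_cf_def
  by (simp add: wirtinger_add[OF assms] algebra_simps sum.distrib sum_subtractf)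

lemma bar0_const [simp]: "bar0 f (\<lambda>x. c) p = 0"
  by (simp add: bar0_def delta_cf_def)

lemma bar0_sum:
  assumes "finite I" "\<And>i. i \<in> I \<Longrightarrow> h i differentiable (at p)"
  shows "bar0 f (\<lambda>x. \<Sum>i\<in>I. h i x) p = (\<Sum>i\<in>I. bar0 f (h i) p)"
  using assms by (induction I) (simp_all add: bar0_add differentiable_sum)

lemma bar0_cong:
  assumes "open S" "p \<in> S" "\<And>x. x \<in> S \<Longrightarrow> g x = h x" "g differentiable (at p)"
  shows "bar0 f g p = bar0 f h p"
  unfolding bar0_def delta_cf_def by (simp add: wirtinger_cong[OF assms])

text \<open>Contracting \<open>N_cf\<close> with \<eta> gives twice the spray, so
  \<open>bar0\<close> differentiates along the spray vector field. In this form it is recognised in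
  \<open>N_can_eq\<close> and \<open>lower_L_berwald\<close>.\<close>

lemma bar0_eq:
  "bar0 f h p = (\<Sum>k\<in>UNIV. snd p $ k * d_z k h p) - 2 * (\<Sum>j\<in>UNIV. spray f j p * d_eta j h p)"
proof -
  have "(\<Sum>k\<in>UNIV. snd p $ k * (\<Sum>j\<in>UNIV. N_cf f j k p * d_eta j h p))
      = (\<Sum>j\<in>UNIV. (\<Sum>k\<in>UNIV. N_cf f j k p * snd p $ k) * d_eta j h p)"
    unfolding sum_distrib_left sum_distrib_right by (subst sum.swap) (simp add: mult_ac)
  then show ?thesis
    by (simp add: bar0_def delta_cf_def right_diff_distrib sum_subtractf spray_def sum_distrib_left)
qed

lemma bar0_eta [simp]:
  "bar0 f (\<lambda>p. snd p $ i) p = - 2 * spray f i p"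
  "bar0 f (\<lambda>p. cnj (snd p $ i)) p = 0"
  by (simp_all add: bar0_eq if_distrib[of "\<lambda>x. _ * x"] cong: if_cong)

section \<open>The difference of the Berwald and Rund coefficients\<close>

context finsler_chart
begin

lemma lower_N_cf:
  "p \<in> S \<Longrightarrow> (\<Sum>i\<in>UNIV. gdown f i m p * N_cf f i j p) = (\<Sum>l\<in>UNIV. d_z j (gdown f l m) p * snd p $ l)"
  using lower_gup[of p m "\<lambda>m. \<Sum>l\<in>UNIV. d_z j (gdown f l m) p * snd p $ l"]
  by (simp add: N_cf_def sum_distrib_left mult.assoc)

lemma lower_spray:
  assumes "p \<in> S"
  shows "(\<Sum>i\<in>UNIV. gdown f i m p * spray f i p)
    = (\<Sum>r\<in>UNIV. snd p $ r * (\<Sum>l\<in>UNIV. d_z r (gdown f l m) p * snd p $ l)) / 2"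
proof -
  have "(\<Sum>i\<in>UNIV. gdown f i m p * spray f i p)
      = (\<Sum>r\<in>UNIV. snd p $ r * (\<Sum>i\<in>UNIV. gdown f i m p * N_cf f i r p)) / 2"
    unfolding spray_def sum_distrib_left sum_divide_distrib
    by (subst sum.swap) (simp add: mult_ac)
  then show ?thesis
    using assms by (simp add: lower_N_cf)
qed

text \<open>This is \<open>lower_spray\<close> differentiated in \<eta>, with the derivative of the
  metric moved to the right.\<close>

lemma lower_N_can:
  assumes p: "p \<in> S"
  shows "2 * (\<Sum>i\<in>UNIV. gdown f i m p * N_can f i j p)
    = (\<Sum>r\<in>UNIV. snd p $ r * d_z r (gdown f j m) p) + (\<Sum>l\<in>UNIV. d_z j (gdown f l m) p * snd p $ l)
      - 2 * (\<Sum>i\<in>UNIV. d_eta j (gdown f i m) p * spray f i p)"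
proof -
  let ?X = "\<lambda>r p. \<Sum>l\<in>UNIV. d_z r (gdown f l m) p * snd p $ l"
  \<comment> \<open>Only the explicit \<eta> contributes: the term with the differentiated metric
    factor vanishes by \<open>eta_d_z_d_eta_gdown\<close>.\<close>
  have X: "d_eta j (?X r) p = d_z r (gdown f j m) p" for r
  proof -
    have "d_eta j (?X r) p = (\<Sum>l\<in>UNIV. d_eta j (d_z r (gdown f l m)) p * snd p $ l
        + d_z r (gdown f l m) p * (if l = j then 1 else 0))"
      by (subst wirtinger_sum wirtinger_mult, (intro finite smooth_differentiable[OF _ p] smooth_intros)+)+ simp
    also have "\<dots> = d_z r (gdown f j m) p"
      using eta_d_z_d_eta_gdown[OF p, of j r m]
      by (simp add: sum.distrib mult.commute if_distrib[of "\<lambda>x. x * _"] cong: if_cong)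
    finally show ?thesis .
  qed
  have "d_eta j (\<lambda>p. \<Sum>i\<in>UNIV. gdown f i m p * spray f i p) p
      = d_eta j (\<lambda>p. (\<Sum>r\<in>UNIV. snd p $ r * ?X r p) * (1 / 2)) p"
    by (rule wirtinger_cong(2)[OF open_S p])
      (simp add: lower_spray, intro smooth_differentiable[OF _ p] smooth_intros smooth_spray)
  also have "\<dots> = (\<Sum>r\<in>UNIV. (if r = j then 1 else 0) * ?X r p + snd p $ r * d_eta j (?X r) p) * (1 / 2)"
    by (subst wirtinger_sum wirtinger_mult,
      (intro finite differentiable_const smooth_differentiable[OF _ p] smooth_intros)+)+ simp
  finally have 1: "d_eta j (\<lambda>p. \<Sum>i\<in>UNIV. gdown f i m p * spray f i p) p
      = (\<Sum>r\<in>UNIV. (if r = j then 1 else 0) * ?X r p + snd p $ r * d_eta j (?X r) p) * (1 / 2)" .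
  have "d_eta j (\<lambda>p. \<Sum>i\<in>UNIV. gdown f i m p * spray f i p) p
      = (\<Sum>i\<in>UNIV. d_eta j (gdown f i m) p * spray f i p + gdown f i m p * N_can f i j p)"
    unfolding N_can_def
    by (subst wirtinger_sum wirtinger_mult,
      (intro finite smooth_differentiable[OF _ p] smooth_intros smooth_spray)+)+ simp
  then show ?thesis
    using 1 unfolding X by (simp add: sum.distrib if_distrib[of "\<lambda>x. x * _"] cong: if_cong) (simp add: field_simps)
qed

lemma lower_C_cf: "p \<in> S \<Longrightarrow> (\<Sum>i\<in>UNIV. gdown f i m p * C_cf f i j k p) = d_eta k (gdown f j m) p"
  unfolding C_cf_def by (rule lower_gup)

lemma lower_L_cf: "p \<in> S \<Longrightarrow> (\<Sum>i\<in>UNIV. gdown f i m p * L_cf f i j k p) = delta_cf f k (gdown f j m) p"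
  unfolding L_cf_def by (rule lower_gup)

lemma C_cf_commute: "p \<in> S \<Longrightarrow> C_cf f h j k p = C_cf f h k j p"
  unfolding C_cf_def by (simp add: d_eta_gdown_commute)

lemma C_cf_eta: "p \<in> S \<Longrightarrow> (\<Sum>k\<in>UNIV. C_cf f h j k p * snd p $ k) = 0"
proof -
  assume p: "p \<in> S"
  have "(\<Sum>k\<in>UNIV. C_cf f h j k p * snd p $ k)
      = (\<Sum>l\<in>UNIV. gup f l h p * (\<Sum>k\<in>UNIV. snd p $ k * d_eta j (gdown f k l) p))"
    using p unfolding C_cf_def sum_distrib_left sum_distrib_right
    by (subst sum.swap) (simp add: d_eta_gdown_commute[of p _ j] mult_ac)
  then show ?thesis using p by (simp add: eta_d_eta_gdown)
qed

text \<open>\<open>L\<^sup>i\<^sub>j\<^sub>0\<close>, through which the derivation \<open>bar0\<close> acts on tensors.\<close>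
definition L_contr :: "'n \<Rightarrow> 'n \<Rightarrow> 'n pt \<Rightarrow> complex" where
  "L_contr i j p = (\<Sum>k\<in>UNIV. L_cf f i j k p * snd p $ k)"

text \<open>Metric compatibility: \<open>L_cf\<close> is the raised \<open>delta_cf\<close>
  derivative of the metric, so only the unbarred index receives a correction.\<close>

lemma bar0_gdown:
  assumes p: "p \<in> S"
  shows "bar0 f (gdown f j m) p = (\<Sum>i\<in>UNIV. gdown f i m p * L_contr i j p)"
proof -
  have "(\<Sum>i\<in>UNIV. gdown f i m p * L_contr i j p)
      = (\<Sum>k\<in>UNIV. snd p $ k * (\<Sum>i\<in>UNIV. gdown f i m p * L_cf f i j k p))"
    unfolding L_contr_def sum_distrib_left by (subst sum.swap) (simp add: mult_ac)
  then show ?thesis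
    using p by (simp add: lower_L_cf bar0_def)
qed

text \<open>After lowering, the vertical part of \<open>delta_cf\<close> drops out by
  \<open>eta_d_eta_gdown\<close>, and what remains is the lowered \<open>N_cf\<close>.\<close>

lemma eta_L_cf:
  assumes p: "p \<in> S"
  shows "(\<Sum>j\<in>UNIV. snd p $ j * L_cf f i j k p) = N_cf f i k p"
proof (rule gdown_cancel[OF p, where X = "\<lambda>i. \<Sum>j\<in>UNIV. snd p $ j * L_cf f i j k p"
      and Y = "\<lambda>i. N_cf f i k p"])
  fix m
  have "(\<Sum>i\<in>UNIV. gdown f i m p * (\<Sum>j\<in>UNIV. snd p $ j * L_cf f i j k p))
      = (\<Sum>j\<in>UNIV. snd p $ j * (\<Sum>i\<in>UNIV. gdown f i m p * L_cf f i j k p))"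
    unfolding sum_distrib_left by (subst sum.swap) (simp add: mult_ac)
  also have "\<dots> = (\<Sum>j\<in>UNIV. snd p $ j * delta_cf f k (gdown f j m) p)"
    using p by (simp add: lower_L_cf)
  also have "\<dots> = (\<Sum>j\<in>UNIV. snd p $ j * d_z k (gdown f j m) p)
      - (\<Sum>j\<in>UNIV. \<Sum>s\<in>UNIV. snd p $ j * (N_cf f s k p * d_eta s (gdown f j m) p))"
    by (simp add: delta_cf_def right_diff_distrib sum_subtractf sum_distrib_left)
  also have "(\<Sum>j\<in>UNIV. \<Sum>s\<in>UNIV. snd p $ j * (N_cf f s k p * d_eta s (gdown f j m) p))
      = (\<Sum>s\<in>UNIV. N_cf f s k p * (\<Sum>j\<in>UNIV. snd p $ j * d_eta s (gdown f j m) p))"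
    unfolding sum_distrib_left by (subst sum.swap) (simp add: mult_ac)
  also have "\<dots> = 0"
    using p by (simp add: eta_d_eta_gdown)
  finally show "(\<Sum>i\<in>UNIV. gdown f i m p * (\<Sum>j\<in>UNIV. snd p $ j * L_cf f i j k p))
      = (\<Sum>i\<in>UNIV. gdown f i m p * N_cf f i k p)"
    using lower_N_cf[OF p, of m k] by (simp add: mult.commute)
qed

text \<open>On the right of \<open>lower_N_can\<close> the first and last terms combine into
  \<open>bar0\<close> of the metric, hence into the lowered \<open>L_contr\<close>; the middle term
  is the lowered \<open>N_cf\<close>.\<close>

lemma N_can_eq:
  assumes p: "p \<in> S"
  shows "2 * N_can f i j p = L_contr i j p + N_cf f i j p"
proof (rule gdown_cancel[OF p, where X = "\<lambda>i. 2 * N_can f i j p" and Y = "\<lambda>i. L_contr i j p + N_cf f i j p"])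
  fix m
  have "(\<Sum>i\<in>UNIV. gdown f i m p * (2 * N_can f i j p)) = 2 * (\<Sum>i\<in>UNIV. gdown f i m p * N_can f i j p)"
    by (simp add: sum_distrib_left mult_ac)
  also have "\<dots> = bar0 f (gdown f j m) p + (\<Sum>l\<in>UNIV. d_z j (gdown f l m) p * snd p $ l)"
  proof -
    have "(\<Sum>i\<in>UNIV. spray f i p * d_eta i (gdown f j m) p) = (\<Sum>i\<in>UNIV. d_eta j (gdown f i m) p * spray f i p)"
      using p by (simp add: d_eta_gdown_commute[of p _ j] mult.commute)
    then show ?thesis
      by (simp only: lower_N_can[OF p] bar0_eq) simp
  qed
  finally show "(\<Sum>i\<in>UNIV. gdown f i m p * (2 * N_can f i j p))
      = (\<Sum>i\<in>UNIV. gdown f i m p * (L_contr i j p + N_cf f i j p))"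
    using p by (simp add: bar0_gdown lower_N_cf distrib_left sum.distrib)
qed

lemma L_contr_eta:
  assumes p: "p \<in> S"
  shows "(\<Sum>j\<in>UNIV. L_contr i j p * snd p $ j) = 2 * spray f i p"
proof -
  have "(\<Sum>j\<in>UNIV. L_contr i j p * snd p $ j) = (\<Sum>k\<in>UNIV. (\<Sum>j\<in>UNIV. snd p $ j * L_cf f i j k p) * snd p $ k)"
    unfolding L_contr_def sum_distrib_right by (subst sum.swap) (simp add: mult_ac)
  then show ?thesis
    using p by (simp add: eta_L_cf spray_def)
qed

text \<open>Euler's relation for the spray as a function of degree two; both summands of
  \<open>N_can_eq\<close> contract with \<eta> to twice the spray.\<close>

lemma N_can_eta:
  assumes p: "p \<in> S"
  shows "(\<Sum>j\<in>UNIV. N_can f i j p * snd p $ j) = 2 * spray f i p"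
proof -
  have "2 * (\<Sum>j\<in>UNIV. N_can f i j p * snd p $ j)
      = (\<Sum>j\<in>UNIV. (2 * N_can f i j p) * snd p $ j)"
    by (simp add: sum_distrib_left mult_ac)
  also have "\<dots> = 2 * spray f i p + (\<Sum>j\<in>UNIV. N_cf f i j p * snd p $ j)"
    using p by (simp add: N_can_eq distrib_right sum.distrib L_contr_eta)
  also have "\<dots> = 2 * (2 * spray f i p)"
    by (simp add: spray_def)
  finally show ?thesis by simp
qed

text \<open>\<open>L\<close> is constant along the spray: the change of the metric, contracted with
  \<eta>, cancels the change of \<eta> by \<open>L_contr_eta\<close>, and the conjugate coordinates
  do not change.\<close>

lemma bar0_L:
  assumes p: "p \<in> S"
  shows "bar0 f L p = 0"
proof -
  have "bar0 f (\<lambda>p. \<Sum>i\<in>UNIV. gdown f i j p * snd p $ i) p = 0" for j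
  proof -
    have "bar0 f (\<lambda>p. \<Sum>i\<in>UNIV. gdown f i j p * snd p $ i) p
        = (\<Sum>i\<in>UNIV. (\<Sum>h\<in>UNIV. gdown f h j p * L_contr h i p) * snd p $ i) - 2 * (\<Sum>i\<in>UNIV. gdown f i j p * spray f i p)"
      by (subst bar0_sum bar0_mult, (intro finite smooth_differentiable[OF _ p] smooth_intros)+)+
        (simp add: bar0_gdown p sum.distrib sum_subtractf sum_distrib_left mult_ac)
    also have "(\<Sum>i\<in>UNIV. (\<Sum>h\<in>UNIV. gdown f h j p * L_contr h i p) * snd p $ i)
        = (\<Sum>h\<in>UNIV. gdown f h j p * (\<Sum>i\<in>UNIV. L_contr h i p * snd p $ i))"
      unfolding sum_distrib_left sum_distrib_right by (subst sum.swap) (simp add: mult_ac)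
    finally show ?thesis
      unfolding L_contr_eta[OF p] by (simp add: sum_distrib_left mult_ac)
  qed
  then have "bar0 f (\<lambda>p. \<Sum>j\<in>UNIV. (\<Sum>i\<in>UNIV. gdown f i j p * snd p $ i) * cnj (snd p $ j)) p = 0"
    by (subst bar0_sum, (intro finite smooth_differentiable[OF _ p] smooth_intros)+,
        subst bar0_mult, (intro finite smooth_differentiable[OF _ p] smooth_intros)+) simp
  moreover have L: "L p = (\<Sum>j\<in>UNIV. (\<Sum>i\<in>UNIV. gdown f i j p * snd p $ i) * cnj (snd p $ j))" if "p \<in> S" for p
    using gdown_eta_eta[OF that] by (subst (asm) sum.swap) (simp add: sum_distrib_right)
  have "bar0 f L p = bar0 f (\<lambda>p. \<Sum>j\<in>UNIV. (\<Sum>i\<in>UNIV. gdown f i j p * snd p $ i) * cnj (snd p $ j)) p"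
    by (rule bar0_cong[OF open_S p L smooth_differentiable[OF smooth_L p]])
  ultimately show ?thesis
    by simp
qed

section \<open>The tensor comparing Berwald and Rund coefficients\<close>

definition landsberg :: "'n \<Rightarrow> 'n \<Rightarrow> 'n \<Rightarrow> 'n pt \<Rightarrow> complex" where
  "landsberg h j k p = bar0 f (C_cf f h j k) p + (\<Sum>i\<in>UNIV. L_contr h i p * C_cf f i j k p)
     - (\<Sum>i\<in>UNIV. C_cf f h i j p * N_can f i k p) - (\<Sum>i\<in>UNIV. C_cf f h i k p * N_can f i j p)"

text \<open>This is \<open>lower_N_can\<close> differentiated once more in \<eta>; the second
  derivatives of the metric against the spray are absorbed by \<open>bar0\<close>.\<close>

lemma lower_L_berwald:
  assumes p: "p \<in> S"
  shows "2 * (\<Sum>i\<in>UNIV. gdown f i m p * L_berwald f i j k p)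
    = d_z k (gdown f j m) p + d_z j (gdown f k m) p + bar0 f (d_eta k (gdown f j m)) p
      - 2 * (\<Sum>i\<in>UNIV. d_eta k (gdown f i m) p * N_can f i j p)
      - 2 * (\<Sum>i\<in>UNIV. d_eta j (gdown f i m) p * N_can f i k p)"
proof -
  let ?A = "\<lambda>p. \<Sum>i\<in>UNIV. gdown f i m p * N_can f i j p"
  let ?B = "\<lambda>p. \<Sum>i\<in>UNIV. d_eta j (gdown f i m) p * spray f i p"
  let ?X = "\<lambda>p. \<Sum>r\<in>UNIV. snd p $ r * d_z r (gdown f j m) p"
  let ?Y = "\<lambda>p. \<Sum>l\<in>UNIV. d_z j (gdown f l m) p * snd p $ l"
  have A: "d_eta k ?A p = (\<Sum>i\<in>UNIV. d_eta k (gdown f i m) p * N_can f i j p)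
      + (\<Sum>i\<in>UNIV. gdown f i m p * L_berwald f i j k p)"
    unfolding L_berwald_def
    by (subst wirtinger_sum wirtinger_mult,
      (intro finite smooth_differentiable[OF _ p] smooth_intros smooth_N_can)+)+ (simp add: sum.distrib)
  have B: "d_eta k ?B p = (\<Sum>i\<in>UNIV. d_eta k (d_eta j (gdown f i m)) p * spray f i p)
      + (\<Sum>i\<in>UNIV. d_eta j (gdown f i m) p * N_can f i k p)"
    unfolding N_can_def
    by (subst wirtinger_sum wirtinger_mult,
      (intro finite smooth_differentiable[OF _ p] smooth_intros smooth_spray)+)+ (simp add: sum.distrib)
  have X: "d_eta k ?X p = d_z k (gdown f j m) p + (\<Sum>r\<in>UNIV. snd p $ r * d_eta k (d_z r (gdown f j m)) p)"
    by (subst wirtinger_sum wirtinger_mult,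
      (intro finite smooth_differentiable[OF _ p] smooth_intros)+)+
      (simp add: sum.distrib if_distrib[of "\<lambda>x. x * _"] cong: if_cong)
  have "d_eta k ?Y p = (\<Sum>l\<in>UNIV. snd p $ l * d_eta k (d_z j (gdown f l m)) p) + d_z j (gdown f k m) p"
    by (subst wirtinger_sum wirtinger_mult,
      (intro finite smooth_differentiable[OF _ p] smooth_intros)+)+
      (simp add: sum.distrib if_distrib[of "\<lambda>x. x * _"] mult.commute cong: if_cong)
  then have Y: "d_eta k ?Y p = d_z j (gdown f k m) p"
    using p by (simp add: eta_d_z_d_eta_gdown)
  have "2 * ?A p + 2 * ?B p = ?X p + ?Y p" if "p \<in> S" for p
    using lower_N_can[OF that] by simp
  then have "d_eta k (\<lambda>p. 2 * ?A p + 2 * ?B p) p = d_eta k (\<lambda>p. ?X p + ?Y p) p"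
    by (intro wirtinger_cong(2)[OF open_S p] smooth_differentiable[OF _ p] smooth_intros
      smooth_on_const smooth_spray smooth_N_can)
  moreover have "d_eta k (\<lambda>p. 2 * ?A p + 2 * ?B p) p = 2 * d_eta k ?A p + 2 * d_eta k ?B p"
    by (subst wirtinger_add wirtinger_mult, (intro finite smooth_differentiable[OF _ p] smooth_intros
      smooth_on_const smooth_spray smooth_N_can)+)+ simp
  moreover have "d_eta k (\<lambda>p. ?X p + ?Y p) p = d_eta k ?X p + d_eta k ?Y p"
    by (intro wirtinger_add finite smooth_differentiable[OF _ p] smooth_intros)
  \<comment> \<open>The index \<open>i\<close> summed against the spray moves into the metric, to
    match the second derivatives coming from \<open>?B\<close>.\<close>
  moreover have "d_eta i (d_eta k (gdown f j m)) p = d_eta k (d_eta j (gdown f i m)) p" for i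
  proof -
    have "d_eta i (d_eta k (gdown f j m)) p = d_eta k (d_eta i (gdown f j m)) p"
      by (rule wirtinger_commute[OF open_S p smooth_gdown])
    also have "\<dots> = d_eta k (d_eta j (gdown f i m)) p"
      by (rule wirtinger_cong(2)[OF open_S p d_eta_gdown_commute smooth_differentiable[OF _ p]])
        (auto intro: smooth_intros)
    finally show ?thesis .
  qed
  then have bar: "(\<Sum>r\<in>UNIV. snd p $ r * d_eta k (d_z r (gdown f j m)) p) = bar0 f (d_eta k (gdown f j m)) p
      + 2 * (\<Sum>i\<in>UNIV. d_eta k (d_eta j (gdown f i m)) p * spray f i p)"
    by (simp add: bar0_eq wirtinger_commute(3)[OF open_S p smooth_gdown] mult.commute)
  ultimately show ?thesis
    unfolding A B X Y bar by (simp add: algebra_simps)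
qed

lemma lower_L_rund:
  assumes p: "p \<in> S"
  shows "2 * (\<Sum>i\<in>UNIV. gdown f i m p * L_rund f i j k p)
    = delta_can f k (gdown f j m) p + delta_can f j (gdown f k m) p"
proof -
  have "2 * (\<Sum>i\<in>UNIV. gdown f i m p * L_rund f i j k p) = (\<Sum>i\<in>UNIV. gdown f i m p *
      (\<Sum>l\<in>UNIV. gup f l i p * (delta_can f k (gdown f j l) p + delta_can f j (gdown f k l) p)))"
    by (simp add: L_rund_def flip: sum_divide_distrib)
  then show ?thesis
    using lower_gup[OF p] by simp
qed

text \<open>Apply \<open>bar0\<close> to \<open>lower_C_cf\<close>: differentiating the lowering
  metric produces the \<open>L_contr\<close> term of \<open>landsberg\<close>, while its two
  \<open>N_can\<close> terms are lowered directly.\<close>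

lemma lower_landsberg:
  assumes p: "p \<in> S"
  shows "(\<Sum>h\<in>UNIV. gdown f h m p * landsberg h j k p) = bar0 f (d_eta k (gdown f j m)) p
      - (\<Sum>i\<in>UNIV. d_eta j (gdown f i m) p * N_can f i k p)
      - (\<Sum>i\<in>UNIV. d_eta k (gdown f i m) p * N_can f i j p)"
proof -
  have "bar0 f (d_eta k (gdown f j m)) p = bar0 f (\<lambda>p. \<Sum>h\<in>UNIV. gdown f h m p * C_cf f h j k p) p"
    by (rule bar0_cong[OF open_S p]) (simp_all add: lower_C_cf smooth_differentiable[OF _ p] smooth_intros)
  also have "\<dots> = (\<Sum>h\<in>UNIV. gdown f h m p * bar0 f (C_cf f h j k) p)
      + (\<Sum>h\<in>UNIV. (\<Sum>i\<in>UNIV. gdown f i m p * L_contr i h p) * C_cf f h j k p)"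
    by (subst bar0_sum bar0_mult, (intro finite smooth_differentiable[OF _ p] smooth_intros smooth_C_cf)+)+
      (simp add: bar0_gdown p sum.distrib add.commute)
  also have "(\<Sum>h\<in>UNIV. (\<Sum>i\<in>UNIV. gdown f i m p * L_contr i h p) * C_cf f h j k p)
      = (\<Sum>i\<in>UNIV. gdown f i m p * (\<Sum>h\<in>UNIV. L_contr i h p * C_cf f h j k p))"
    unfolding sum_distrib_left sum_distrib_right by (subst sum.swap) (simp add: mult_ac)
  finally have 1: "bar0 f (d_eta k (gdown f j m)) p = (\<Sum>h\<in>UNIV. gdown f h m p * bar0 f (C_cf f h j k) p)
      + (\<Sum>i\<in>UNIV. gdown f i m p * (\<Sum>h\<in>UNIV. L_contr i h p * C_cf f h j k p))" .
  have 2: "(\<Sum>h\<in>UNIV. gdown f h m p * (\<Sum>i\<in>UNIV. C_cf f h i j p * N_can f i k p))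
      = (\<Sum>i\<in>UNIV. d_eta j (gdown f i m) p * N_can f i k p)" for j k
  proof -
    have "(\<Sum>h\<in>UNIV. gdown f h m p * (\<Sum>i\<in>UNIV. C_cf f h i j p * N_can f i k p))
        = (\<Sum>i\<in>UNIV. (\<Sum>h\<in>UNIV. gdown f h m p * C_cf f h i j p) * N_can f i k p)"
      unfolding sum_distrib_left sum_distrib_right by (subst sum.swap) (simp add: mult_ac)
    then show ?thesis using p by (simp add: lower_C_cf)
  qed
  show ?thesis
    unfolding landsberg_def right_diff_distrib distrib_left sum.distrib sum_subtractf 1 2 ..
qed

text \<open>After lowering, the z-derivatives of the metric cancel. The \<open>N_can\<close>
  corrections have weight two in the Berwald and one in the Rund expression, so each survives once,
  as in \<open>lower_landsberg\<close>.\<close>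

lemma berwald_minus_rund:
  assumes p: "p \<in> S"
  shows "2 * (L_berwald f h j k p - L_rund f h j k p) = landsberg h j k p"
proof (rule gdown_cancel[OF p, where X = "\<lambda>h. 2 * (L_berwald f h j k p - L_rund f h j k p)"
      and Y = "\<lambda>h. landsberg h j k p"])
  fix m
  have "(\<Sum>h\<in>UNIV. gdown f h m p * (2 * (L_berwald f h j k p - L_rund f h j k p)))
      = 2 * (\<Sum>h\<in>UNIV. gdown f h m p * L_berwald f h j k p) - 2 * (\<Sum>h\<in>UNIV. gdown f h m p * L_rund f h j k p)"
    by (simp add: sum_distrib_left sum_subtractf algebra_simps)
  also have "\<dots> = bar0 f (d_eta k (gdown f j m)) p
      - (\<Sum>i\<in>UNIV. d_eta j (gdown f i m) p * N_can f i k p)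
      - (\<Sum>i\<in>UNIV. d_eta k (gdown f i m) p * N_can f i j p)"
    using p by (simp add: lower_L_berwald lower_L_rund delta_can_def d_eta_gdown_commute[of p _ j]
        d_eta_gdown_commute[of p _ k] mult.commute)
  finally show "(\<Sum>h\<in>UNIV. gdown f h m p * (2 * (L_berwald f h j k p - L_rund f h j k p)))
      = (\<Sum>h\<in>UNIV. gdown f h m p * landsberg h j k p)"
    using p by (simp add: lower_landsberg)
qed

lemma landsberg_commute:
  assumes p: "p \<in> S"
  shows "landsberg h j k p = landsberg h k j p"
proof -
  have "bar0 f (C_cf f h j k) p = bar0 f (C_cf f h k j) p"
    by (rule bar0_cong[OF open_S p]) (simp_all add: C_cf_commute smooth_differentiable[OF smooth_C_cf p])
  then show ?thesis
    using p by (simp add: landsberg_def C_cf_commute[of p _ j k])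
qed

text \<open>Applying \<open>bar0\<close> to \<open>C_cf_eta\<close> yields twice \<open>C_cf\<close>
  against the spray, which the first \<open>N_can\<close> sum cancels by \<open>N_can_eta\<close>.
  The other sums contain \<open>C_cf\<close> contracted with \<eta>.\<close>

lemma landsberg_eta:
  assumes p: "p \<in> S"
  shows "(\<Sum>k\<in>UNIV. landsberg h j k p * snd p $ k) = 0"
proof -
  have "0 = bar0 f (\<lambda>p. \<Sum>k\<in>UNIV. C_cf f h j k p * snd p $ k) p"
    by (subst bar0_cong[OF open_S p, where h = "\<lambda>_. 0"])
      (simp_all only: C_cf_eta bar0_const, intro smooth_differentiable[OF _ p] smooth_intros smooth_C_cf)
  also have "\<dots> = (\<Sum>k\<in>UNIV. bar0 f (C_cf f h j k) p * snd p $ k) - 2 * (\<Sum>k\<in>UNIV. C_cf f h j k p * spray f k p)"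
    by (subst bar0_sum bar0_mult, (intro finite smooth_differentiable[OF _ p] smooth_intros smooth_C_cf)+)+
      (simp add: sum.distrib sum_subtractf sum_distrib_left mult_ac)
  finally have 1: "(\<Sum>k\<in>UNIV. bar0 f (C_cf f h j k) p * snd p $ k) = 2 * (\<Sum>k\<in>UNIV. C_cf f h j k p * spray f k p)"
    by simp
  have 2: "(\<Sum>k\<in>UNIV. (\<Sum>i\<in>UNIV. L_contr h i p * C_cf f i j k p) * snd p $ k)
      = (\<Sum>i\<in>UNIV. L_contr h i p * (\<Sum>k\<in>UNIV. C_cf f i j k p * snd p $ k))"
    unfolding sum_distrib_left sum_distrib_right by (subst sum.swap) (simp add: mult_ac)
  have 3: "(\<Sum>k\<in>UNIV. (\<Sum>i\<in>UNIV. C_cf f h i j p * N_can f i k p) * snd p $ k)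
      = (\<Sum>i\<in>UNIV. C_cf f h i j p * (\<Sum>k\<in>UNIV. N_can f i k p * snd p $ k))"
    unfolding sum_distrib_left sum_distrib_right by (subst sum.swap) (simp add: mult_ac)
  have 4: "(\<Sum>k\<in>UNIV. (\<Sum>i\<in>UNIV. C_cf f h i k p * N_can f i j p) * snd p $ k)
      = (\<Sum>i\<in>UNIV. N_can f i j p * (\<Sum>k\<in>UNIV. C_cf f h i k p * snd p $ k))"
    unfolding sum_distrib_left sum_distrib_right by (subst sum.swap) (simp add: mult_ac)
  show ?thesis
    unfolding landsberg_def left_diff_distrib distrib_right sum.distrib sum_subtractf 1 2 3 4
      C_cf_eta[OF p] N_can_eta[OF p]
    by (simp add: C_cf_commute[OF p, of h _ j] sum_distrib_left mult_ac)
qed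

end

section \<open>The Berwald frame\<close>

locale finsler_chart_2 = finsler_chart U f for U :: "(complex^2) set" and f :: "2 pt \<Rightarrow> real"
begin

lemma f_pos: "p \<in> S \<Longrightarrow> 0 < f p"
  using pos by (cases p) auto

lemma det_gmat_pos:
  assumes p: "p \<in> S"
  obtains r where "0 < r" "det (gmat f p) = complex_of_real r"
proof -
  define a b c where "a = gmat f p $ 1 $ 1" and "b = gmat f p $ 1 $ 2" and "c = gmat f p $ 2 $ 2"
  have herm: "\<And>i j. gmat f p $ j $ i = cnj (gmat f p $ i $ j)"
    and form: "\<And>v. v \<noteq> 0 \<Longrightarrow> 0 < Re (\<Sum>i\<in>UNIV. \<Sum>j\<in>UNIV. gmat f p $ i $ j * v $ i * cnj (v $ j))"
    using pos_def[OF p] unfolding pos_def_hermitian_def by blast+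
  have real: "a = of_real (Re a)" "c = of_real (Re c)" and b: "gmat f p $ 2 $ 1 = cnj b"
    using herm[of 1 1] herm[of 2 2] herm[of 1 2] by (simp_all add: a_def b_def c_def complex_eq_iff)
  have c: "0 < Re c"
    using form[of "axis 2 1", unfolded axis_eq_0_iff] by (simp add: sum_2 axis_def c_def)
  define r where "r = Re a * Re c - (cmod b)\<^sup>2"
  have r: "a * c - b * cnj b = of_real r"
    by (subst real(1), subst real(2)) (simp only: r_def of_real_diff of_real_mult complex_norm_square)
  then have det: "det (gmat f p) = of_real r"
    using r b by (simp add: det_2 a_def b_def c_def)
  \<comment> \<open>This vector makes the Hermitian form equal to \<open>c\<close> times the
    determinant, where the real number \<open>c\<close> is already known to be positive.\<close>
  define v :: "complex^2" where "v = (\<chi> i. if i = 1 then c else - b)"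
  have "v \<noteq> 0" using c by (auto simp: v_def vec_eq_iff forall_2)
  then have "0 < Re (a * c * cnj c - b * c * cnj b - cnj b * b * cnj c + c * b * cnj b)"
    using form[of v] by (simp add: sum_2 v_def a_def[symmetric] b_def[symmetric] c_def[symmetric] b)
  also have "a * c * cnj c - b * c * cnj b - cnj b * b * cnj c + c * b * cnj b = c * (a * c - b * cnj b)"
    using herm[of 2 2] by (simp add: c_def algebra_simps)
  also have "\<dots> = of_real (Re c * r)"
    unfolding r of_real_mult by (subst real(2)) simp
  finally have "0 < r" using c by (simp add: zero_less_mult_iff)
  with det that show ?thesis by blast
qed

lemma F_square: "complex_of_real (f p) * complex_of_real (f p) = L p"
  by (simp add: L_def power2_eq_square)

lemma sqrt_g_square: "sqrt_g f p * sqrt_g f p = det (gmat f p)"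
  by (simp add: sqrt_g_def flip: power2_eq_square)

lemma sqrt_g_nz: "p \<in> S \<Longrightarrow> sqrt_g f p \<noteq> 0"
  using det_gmat_pos[of p] sqrt_g_square[of p] by (metis less_irrefl mult_zero_left of_real_eq_0_iff)

lemma differentiable_F:
  assumes p: "p \<in> S"
  shows "(\<lambda>p. complex_of_real (f p)) differentiable (at p)"
proof -
  obtain D where D: "((\<lambda>p. (f p)\<^sup>2) has_derivative D) (at p)"
    using smooth_differentiable[OF smooth_f_sq p] by (auto simp: differentiable_def)
  have "0 < (f p)\<^sup>2" using f_pos[OF p] by simp
  then obtain D' where "((\<lambda>p. complex_of_real (sqrt ((f p)\<^sup>2))) has_derivative D') (at p)"
    using bounded_linear.has_derivative[OF bounded_linear_of_real
      has_derivative_compose[OF D DERIV_real_sqrt[unfolded has_field_derivative_def]]] by blast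
  moreover have "complex_of_real (sqrt ((f q)\<^sup>2)) = complex_of_real (f q)" if "q \<in> S" for q
    using f_pos[OF that] by simp
  ultimately have "((\<lambda>p. complex_of_real (f p)) has_derivative D') (at p)"
    by (rule has_derivative_transform_within_open[OF _ open_S p])
  then show ?thesis
    unfolding differentiable_def by blast
qed

lemma differentiable_det_gmat: "p \<in> S \<Longrightarrow> (\<lambda>p. det (gmat f p)) differentiable (at p)"
  by (rule smooth_differentiable[OF smooth_on_det[OF open_S]]) (simp_all add: gmat_def smooth_gdown)

lemma differentiable_sqrt_g:
  assumes p: "p \<in> S"
  shows "sqrt_g f differentiable (at p)"
proof -
  obtain D where D: "((\<lambda>p. det (gmat f p)) has_derivative D) (at p)"
    using differentiable_det_gmat[OF p] by (auto simp: differentiable_def)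
  \<comment> \<open>The determinant is a positive real, away from the branch cut of
    \<open>csqrt\<close>.\<close>
  have "det (gmat f p) \<notin> \<real>\<^sub>\<le>\<^sub>0"
    using det_gmat_pos[OF p] by (metis complex_nonpos_Reals_iff Re_complex_of_real not_less)
  from has_derivative_compose[OF D has_field_derivative_csqrt[OF this, unfolded has_field_derivative_def]]
  show ?thesis
    unfolding sqrt_g_def[abs_def] differentiable_def by blast
qed

lemma differentiable_frame:
  assumes p: "p \<in> S"
  shows "l_up f i differentiable (at p)" "l_down f i differentiable (at p)"
    "m_up f i differentiable (at p)" "m_down f i differentiable (at p)"
proof -
  note d = differentiable_F[OF p] differentiable_sqrt_g[OF p] smooth_differentiable[OF smooth_eta(1) p]
    smooth_differentiable[OF smooth_eta(2) p] smooth_differentiable[OF smooth_gdown p]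
  have nz: "complex_of_real (f p) \<noteq> 0" using f_pos[OF p] by simp
  show up: "l_up f i differentiable (at p)" for i
    unfolding l_up_def[abs_def] by (intro differentiable_divide d nz)
  show down: "l_down f i differentiable (at p)" for i
    unfolding l_down_def[abs_def]
    by (intro differentiable_divide differentiable_sum differentiable_mult d nz ballI) simp
  show "m_up f i differentiable (at p)"
    unfolding m_up_def[abs_def]
    by (cases "i = 1") (simp_all add: differentiable_divide differentiable_minus d down sqrt_g_nz[OF p])
  show "m_down f i differentiable (at p)"
    unfolding m_down_def[abs_def]
    by (cases "i = 1") (simp_all add: differentiable_mult differentiable_minus d up)
qed

lemma l_dual:
  assumes p: "p \<in> S"
  shows "l_down f 1 p * l_up f 1 p + l_down f 2 p * l_up f 2 p = 1"
proof -
  have nz: "complex_of_real (f p) \<noteq> 0" using f_pos[OF p] by simp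
  have "l_down f 1 p * l_up f 1 p + l_down f 2 p * l_up f 2 p
      = (\<Sum>i\<in>UNIV. \<Sum>j\<in>UNIV. gdown f i j p * snd p $ i * cnj (snd p $ j))
        / (complex_of_real (f p) * complex_of_real (f p))"
    using nz by (simp add: l_down_def l_up_def sum_2 field_simps)
  also have "\<dots> = 1"
    using gdown_eta_eta[OF p] F_square[of p] nz by auto
  finally show ?thesis .
qed

text \<open>The components of \<open>m\<close> are rotated components of \<open>l\<close>, and the
  factors \<open>sqrt_g\<close> cancel in products of an upper with a lower one, so everything
  reduces to \<open>l_dual\<close>.\<close>

lemma frame_dual:
  assumes p: "p \<in> S"
  shows "(\<Sum>i\<in>UNIV. m_down f i p * m_up f i p) = 1"
    and "l_down f i p * l_up f j p + m_down f i p * m_up f j p = (if i = j then 1 else 0)"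
  using l_dual[OF p] sqrt_g_nz[OF p] exhaust_2[of i] exhaust_2[of j]
  by (auto simp: sum_2 m_down_def m_up_def algebra_simps)

lemma frame_expand:
  assumes p: "p \<in> S"
  shows "x j = (\<Sum>h\<in>UNIV. l_down f h p * x h) * l_up f j p + (\<Sum>h\<in>UNIV. m_down f h p * x h) * m_up f j p"
proof -
  have "(\<Sum>h\<in>UNIV. l_down f h p * x h) * l_up f j p + (\<Sum>h\<in>UNIV. m_down f h p * x h) * m_up f j p
      = (\<Sum>h\<in>UNIV. (l_down f h p * l_up f j p + m_down f h p * m_up f j p) * x h)"
    by (simp add: sum_2 algebra_simps)
  then show ?thesis
    by (simp add: frame_dual(2)[OF p] if_distrib[of "\<lambda>x. x * _"] cong: if_cong)
qed

text \<open>In dimension two, a slot that is killed by \<eta> carries only multiples of the covector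
  \<open>m\<close>; symmetry transfers this to the other slot.\<close>

lemma frame_symmetric:
  assumes p: "p \<in> S" and sym: "\<And>j k. X j k = X k j"
    and eta: "\<And>j. (\<Sum>k\<in>UNIV. X j k * snd p $ k) = 0"
  shows "X j k = m_down f j p * m_down f k p * (\<Sum>a\<in>UNIV. \<Sum>b\<in>UNIV. m_up f a p * m_up f b p * X b a)"
proof -
  have u: "X j 1 * l_up f 1 p + X j 2 * l_up f 2 p = 0" for j
    using eta[of j] by (simp add: l_up_def sum_2 flip: add_divide_distrib)
  \<comment> \<open>The completeness relation \<open>frame_dual\<close> is inserted in the slot
    \<open>k\<close>; its \<open>l\<close> part vanishes by \<open>u\<close>.\<close>
  have 1: "X j k = m_down f k p * (\<Sum>a\<in>UNIV. m_up f a p * X j a)" for j k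
  proof -
    have "(\<Sum>a\<in>UNIV. (if k = a then 1 else 0) * X j a)
        = l_down f k p * (\<Sum>a\<in>UNIV. X j a * l_up f a p) + m_down f k p * (\<Sum>a\<in>UNIV. m_up f a p * X j a)"
      by (simp add: sum_distrib_left flip: frame_dual(2)[OF p] sum.distrib) (simp add: algebra_simps)
    then show ?thesis
      by (simp add: sum_2[of "\<lambda>a. X j a * l_up f a p"] u if_distrib[of "\<lambda>x. x * _"] cong: if_cong)
  qed
  have "X j k = m_down f k p * (\<Sum>a\<in>UNIV. m_up f a p * (m_down f j p * (\<Sum>b\<in>UNIV. m_up f b p * X a b)))"
    by (subst 1, subst sym, subst 1) (rule refl)
  then show ?thesis
    by (simp add: sum_distrib_left mult_ac sym)
qed

section \<open>Action of \<open>bar0\<close> on the Berwald frame\<close>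

lemma bar0_F:
  assumes p: "p \<in> S"
  shows "bar0 f (\<lambda>p. complex_of_real (f p)) p = 0"
proof -
  have "bar0 f L p = bar0 f (\<lambda>p. complex_of_real (f p) * complex_of_real (f p)) p"
    by (simp add: F_square)
  also have "\<dots> = 2 * complex_of_real (f p) * bar0 f (\<lambda>p. complex_of_real (f p)) p"
    by (simp add: bar0_mult differentiable_F[OF p])
  finally show ?thesis
    using bar0_L[OF p] f_pos[OF p] by simp
qed

lemma bar0_l_up:
  assumes p: "p \<in> S"
  shows "bar0 f (l_up f i) p = - (\<Sum>j\<in>UNIV. L_contr i j p * l_up f j p)"
proof -
  have nz: "complex_of_real (f p) \<noteq> 0" using f_pos[OF p] by simp
  have "bar0 f (\<lambda>p. snd p $ i) p = bar0 f (\<lambda>p. complex_of_real (f p) * l_up f i p) p"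
  proof (rule bar0_cong[OF open_S p _ smooth_differentiable[OF smooth_eta(1) p]])
    show "snd q $ i = complex_of_real (f q) * l_up f i q" if "q \<in> S" for q
      using f_pos[OF that] by (simp add: l_up_def)
  qed
  also have "\<dots> = complex_of_real (f p) * bar0 f (l_up f i) p"
    by (simp add: bar0_mult differentiable_F[OF p] differentiable_frame[OF p] bar0_F[OF p])
  finally have "complex_of_real (f p) * bar0 f (l_up f i) p = - (\<Sum>j\<in>UNIV. L_contr i j p * snd p $ j)"
    by (simp add: L_contr_eta[OF p])
  then show ?thesis
    using nz by (simp add: l_up_def field_simps flip: sum_divide_distrib)
qed

lemma bar0_l_down:
  assumes p: "p \<in> S"
  shows "bar0 f (l_down f i) p = (\<Sum>j\<in>UNIV. L_contr j i p * l_down f j p)"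
proof -
  have nz: "complex_of_real (f p) \<noteq> 0" using f_pos[OF p] by simp
  have lower: "(\<Sum>j\<in>UNIV. gdown f i j q * cnj (snd q $ j)) = complex_of_real (f q) * l_down f i q"
    if "q \<in> S" for i q
    using f_pos[OF that] by (simp add: l_down_def)
  have "bar0 f (\<lambda>p. \<Sum>j\<in>UNIV. gdown f i j p * cnj (snd p $ j)) p
      = bar0 f (\<lambda>p. complex_of_real (f p) * l_down f i p) p"
    by (rule bar0_cong[OF open_S p lower]) (assumption | intro smooth_differentiable[OF _ p] smooth_intros)+
  also have "\<dots> = complex_of_real (f p) * bar0 f (l_down f i) p"
    by (simp add: bar0_mult differentiable_F[OF p] differentiable_frame[OF p] bar0_F[OF p])
  also have "bar0 f (\<lambda>p. \<Sum>j\<in>UNIV. gdown f i j p * cnj (snd p $ j)) p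
      = (\<Sum>j\<in>UNIV. (\<Sum>h\<in>UNIV. gdown f h j p * L_contr h i p) * cnj (snd p $ j))"
    by (subst bar0_sum bar0_mult, (intro finite smooth_differentiable[OF _ p] smooth_intros)+)+
      (simp add: bar0_gdown[OF p])
  also have "\<dots> = (\<Sum>h\<in>UNIV. L_contr h i p * (\<Sum>j\<in>UNIV. gdown f h j p * cnj (snd p $ j)))"
    unfolding sum_distrib_left sum_distrib_right by (subst sum.swap) (simp add: mult_ac)
  finally have "complex_of_real (f p) * bar0 f (l_down f i) p
      = complex_of_real (f p) * (\<Sum>h\<in>UNIV. L_contr h i p * l_down f h p)"
    unfolding lower[OF p] by (simp add: sum_distrib_left mult_ac)
  then show ?thesis
    using nz by simp
qed

text \<open>Jacobi's formula: by \<open>bar0_gdown\<close> the logarithmic derivative of the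
  determinant is the trace of \<open>L_contr\<close>, and the square root takes half of it.\<close>

lemma bar0_sqrt_g:
  assumes p: "p \<in> S"
  shows "bar0 f (sqrt_g f) p = sqrt_g f p * (\<Sum>i\<in>UNIV. L_contr i i p) / 2"
proof -
  have det: "det (gmat f p) = gdown f 1 1 p * gdown f 2 2 p + - 1 * (gdown f 1 2 p * gdown f 2 1 p)" for p
    by (simp add: det_2 gmat_def)
  have "2 * sqrt_g f p * bar0 f (sqrt_g f) p = bar0 f (\<lambda>p. sqrt_g f p * sqrt_g f p) p"
    by (simp add: bar0_mult differentiable_sqrt_g[OF p])
  also have "\<dots> = det (gmat f p) * (\<Sum>i\<in>UNIV. L_contr i i p)"
    unfolding sqrt_g_square det
    by (subst bar0_add bar0_mult, (intro differentiable_const smooth_differentiable[OF _ p] smooth_intros smooth_on_const)+)+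
      (simp add: bar0_gdown[OF p] sum_2 algebra_simps)
  finally show ?thesis
    using sqrt_g_nz[OF p] by (simp add: field_simps flip: sqrt_g_square)
qed

lemma m_components:
  "m_up f 1 = (\<lambda>p. - 1 * (l_down f 2 p / sqrt_g f p))" "m_up f 2 = (\<lambda>p. l_down f 1 p / sqrt_g f p)"
  "m_down f 1 = (\<lambda>p. - 1 * (sqrt_g f p * l_up f 2 p))" "m_down f 2 = (\<lambda>p. sqrt_g f p * l_up f 1 p)"
  by (auto simp: m_up_def m_down_def)

text \<open>\<open>m_down\<close> is \<open>l_up\<close> turned by a quarter and scaled by
  \<open>sqrt_g\<close>. In dimension two the turn changes minus \<open>L_contr\<close> into its
  transpose minus the trace; the factor \<open>sqrt_g\<close> gives half of the trace back.\<close>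

lemma bar0_m_down:
  assumes p: "p \<in> S"
  shows "bar0 f (m_down f h) p = (\<Sum>i\<in>UNIV. L_contr i h p * m_down f i p) - (\<Sum>i\<in>UNIV. L_contr i i p) * m_down f h p / 2"
proof -
  have "bar0 f (m_down f 1) p = (\<Sum>i\<in>UNIV. L_contr i 1 p * m_down f i p) - (\<Sum>i\<in>UNIV. L_contr i i p) * m_down f 1 p / 2"
    unfolding m_components(3) bar0_mult[OF differentiable_const differentiable_mult[OF differentiable_sqrt_g[OF p] differentiable_frame(1)[OF p]]]
      bar0_mult[OF differentiable_sqrt_g[OF p] differentiable_frame(1)[OF p]]
    by (simp add: bar0_sqrt_g[OF p] bar0_l_up[OF p] m_components sum_2 field_simps)
  moreover have "bar0 f (m_down f 2) p = (\<Sum>i\<in>UNIV. L_contr i 2 p * m_down f i p) - (\<Sum>i\<in>UNIV. L_contr i i p) * m_down f 2 p / 2"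
    unfolding m_components(4) bar0_mult[OF differentiable_sqrt_g[OF p] differentiable_frame(1)[OF p]]
    by (simp add: bar0_sqrt_g[OF p] bar0_l_up[OF p] m_components sum_2 field_simps)
  ultimately show ?thesis
    using exhaust_2[of h] by auto
qed

lemma bar0_m_up:
  assumes p: "p \<in> S"
  shows "bar0 f (m_up f h) p = (\<Sum>i\<in>UNIV. L_contr i i p) * m_up f h p / 2 - (\<Sum>i\<in>UNIV. L_contr h i p * m_up f i p)"
proof -
  \<comment> \<open>The product \<open>sqrt_g f p * m_up f h p\<close> is a component of
    \<open>l_down\<close> up to sign, so its derivative is known and no quotient rule is
    needed.\<close>
  have prod: "bar0 f (sqrt_g f) p * m_up f h p + sqrt_g f p * bar0 f (m_up f h) p = bar0 f (\<lambda>p. sqrt_g f p * m_up f h p) p" for h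
    by (simp add: bar0_mult differentiable_sqrt_g[OF p] differentiable_frame[OF p])
  have sm: "sqrt_g f q * m_up f 1 q = - 1 * l_down f 2 q" "sqrt_g f q * m_up f 2 q = l_down f 1 q"
    if "q \<in> S" for q
    using sqrt_g_nz[OF that] by (simp_all add: m_components)
  have "bar0 f (\<lambda>p. sqrt_g f p * m_up f 1 p) p = bar0 f (\<lambda>p. - 1 * l_down f 2 p) p"
    by (intro bar0_cong[OF open_S p sm(1)] differentiable_mult differentiable_sqrt_g[OF p] differentiable_frame[OF p])
  moreover have "bar0 f (\<lambda>p. sqrt_g f p * m_up f 2 p) p = bar0 f (l_down f 1) p"
    by (intro bar0_cong[OF open_S p sm(2)] differentiable_mult differentiable_sqrt_g[OF p] differentiable_frame[OF p])
  ultimately have "sqrt_g f p * bar0 f (m_up f 1) p = - bar0 f (l_down f 2) p - bar0 f (sqrt_g f) p * m_up f 1 p"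
    "sqrt_g f p * bar0 f (m_up f 2) p = bar0 f (l_down f 1) p - bar0 f (sqrt_g f) p * m_up f 2 p"
    using prod[of 1] prod[of 2] bar0_mult[OF differentiable_const differentiable_frame(2)[OF p], of f "- 1" 2]
    by (simp_all add: algebra_simps)
  moreover have "l_down f 1 p = sqrt_g f p * m_up f 2 p" "l_down f 2 p = - (sqrt_g f p * m_up f 1 p)"
    using sqrt_g_nz[OF p] by (simp_all add: m_components)
  ultimately have "sqrt_g f p * bar0 f (m_up f h) p
      = sqrt_g f p * ((\<Sum>i\<in>UNIV. L_contr i i p) * m_up f h p / 2 - (\<Sum>i\<in>UNIV. L_contr h i p * m_up f i p))"
    using exhaust_2[of h] by (auto simp: bar0_l_down[OF p] bar0_sqrt_g[OF p] sum_2 field_simps)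
  then show ?thesis
    using sqrt_g_nz[OF p] by simp
qed

section \<open>The scalars \<open>J\<close>, \<open>Y\<close>, \<open>E\<close> and the frame form
  of \<open>C_cf\<close>\<close>

lemma scal_JYE:
  assumes p: "p \<in> S"
  shows "of_real (f p) * scal_J f p = (\<Sum>i\<in>UNIV. \<Sum>j\<in>UNIV. l_down f i p * L_contr i j p * l_up f j p)"
    and "of_real (f p) * scal_Y f p = (\<Sum>i\<in>UNIV. \<Sum>j\<in>UNIV. m_down f i p * L_contr i j p * m_up f j p)"
    and "of_real (f p) * scal_E f p = (\<Sum>i\<in>UNIV. \<Sum>j\<in>UNIV. m_down f i p * N_cf f i j p * m_up f j p)"
proof -
  \<comment> \<open>The factor \<open>f p\<close> turns one \<open>l_up\<close> into \<eta>. In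
    \<open>J\<close> and \<open>Y\<close> it contracts the last index of \<open>L_cf\<close>, giving
    \<open>L_contr\<close>; in \<open>E\<close> the first lower one, giving \<open>N_cf\<close> by
    \<open>eta_L_cf\<close>.\<close>
  have \<eta>: "snd p $ k = of_real (f p) * l_up f k p" for k
    using f_pos[OF p] by (simp add: l_up_def)
  show "of_real (f p) * scal_J f p = (\<Sum>i\<in>UNIV. \<Sum>j\<in>UNIV. l_down f i p * L_contr i j p * l_up f j p)"
    "of_real (f p) * scal_Y f p = (\<Sum>i\<in>UNIV. \<Sum>j\<in>UNIV. m_down f i p * L_contr i j p * m_up f j p)"
    "of_real (f p) * scal_E f p = (\<Sum>i\<in>UNIV. \<Sum>j\<in>UNIV. m_down f i p * N_cf f i j p * m_up f j p)"
    by (simp_all add: scal_J_def scal_Y_def scal_E_def L_contr_def \<eta> sum_2 algebra_simps flip: eta_L_cf[OF p])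
qed

text \<open>By the completeness relation \<open>frame_dual\<close> the trace can be taken in the
  Berwald frame, where its diagonal entries are \<open>F J\<close> and \<open>F Y\<close>.\<close>

lemma trace_L_contr:
  assumes p: "p \<in> S"
  shows "(\<Sum>i\<in>UNIV. L_contr i i p) = of_real (f p) * (scal_J f p + scal_Y f p)"
proof -
  have "of_real (f p) * (scal_J f p + scal_Y f p)
      = (\<Sum>i\<in>UNIV. \<Sum>j\<in>UNIV. (l_down f i p * l_up f j p + m_down f i p * m_up f j p) * L_contr i j p)"
    unfolding distrib_left scal_JYE[OF p] by (simp add: sum_2 algebra_simps)
  then show ?thesis
    by (simp add: frame_dual(2)[OF p] sum_2)
qed

lemma C_cf_frame:
  assumes p: "p \<in> S"
  shows "C_cf f h j k p = m_down f j p * m_down f k p * (scal_A f p * l_up f h p + scal_B f p * m_up f h p)"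
proof -
  define x where "x h = (\<Sum>a\<in>UNIV. \<Sum>b\<in>UNIV. m_up f a p * m_up f b p * C_cf f h b a p)" for h
  have "C_cf f h j k p = m_down f j p * m_down f k p * x h" for h j k
    unfolding x_def by (rule frame_symmetric[OF p C_cf_commute[OF p] C_cf_eta[OF p]])
  moreover have "(\<Sum>h\<in>UNIV. l_down f h p * x h) = scal_A f p" "(\<Sum>h\<in>UNIV. m_down f h p * x h) = scal_B f p"
    unfolding x_def scal_A_def scal_B_def C_cf_commute[OF p, of _ 2 1] by (simp_all add: sum_2 algebra_simps)
  ultimately show ?thesis
    using frame_expand[OF p, of x h] by simp
qed

text \<open>The sum on the left is \<open>A\<close> when \<open>w\<close> is the covector \<open>l\<close>, and \<open>B\<close> when \<open>w\<close> is the covector \<open>m\<close>.\<close>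
lemma bar0_C_contract:
  assumes p: "p \<in> S" and w: "\<And>h. w h differentiable (at p)"
    and x: "\<And>h. x h = scal_A f p * l_up f h p + scal_B f p * m_up f h p"
  shows "bar0 f (\<lambda>p. \<Sum>j\<in>UNIV. \<Sum>k\<in>UNIV. \<Sum>h\<in>UNIV. m_up f j p * m_up f k p * w h p * C_cf f h k j p) p
    = (\<Sum>j\<in>UNIV. \<Sum>k\<in>UNIV. \<Sum>h\<in>UNIV. m_up f j p * m_up f k p * w h p * landsberg h k j p)
    + of_real (f p) * (scal_J f p + scal_E f p) * (\<Sum>h\<in>UNIV. w h p * x h)
    + (\<Sum>h\<in>UNIV. (bar0 f (w h) p - (\<Sum>i\<in>UNIV. L_contr i h p * w i p)) * x h)"
proof -
  \<comment> \<open>\<open>?\<mu>\<close> measures the change of \<open>m_up\<close> along itself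
    and \<open>?\<nu>\<close> the \<open>N_can\<close> correction in that direction; each of the two
    lower slots of \<open>C_cf\<close> contributes their sum.\<close>
  let ?\<mu> = "\<Sum>j\<in>UNIV. bar0 f (m_up f j) p * m_down f j p"
  let ?\<nu> = "\<Sum>i\<in>UNIV. \<Sum>j\<in>UNIV. m_down f i p * N_can f i j p * m_up f j p"
  let ?FY = "\<Sum>i\<in>UNIV. \<Sum>j\<in>UNIV. m_down f i p * L_contr i j p * m_up f j p"
  have C: "C_cf f h j k p = m_down f j p * m_down f k p * x h" for h j k
    using C_cf_frame[OF p] x by simp
  have mm: "(\<Sum>i\<in>UNIV. m_down f i p * m_up f i p) = 1"
    by (rule frame_dual(1)[OF p])
  \<comment> \<open>As \<open>C_cf\<close> is a product in its two lower indices, the triple sums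
    factor into single sums.\<close>
  have contract: "(\<Sum>j\<in>UNIV. \<Sum>k\<in>UNIV. \<Sum>h\<in>UNIV. a j * b k * c h * (m_down f k p * m_down f j p * y h))
      = (\<Sum>j\<in>UNIV. a j * m_down f j p) * (\<Sum>k\<in>UNIV. m_down f k p * b k) * (\<Sum>h\<in>UNIV. c h * y h)"
    for a b c y :: "2 \<Rightarrow> complex"
    by (simp add: sum_2 algebra_simps)
  \<comment> \<open>The definition of \<open>landsberg\<close>, solved for the derivative of
    \<open>C_cf\<close>.\<close>
  have bar0_C: "bar0 f (C_cf f h k j) p = landsberg h k j p - m_down f k p * m_down f j p * (\<Sum>i\<in>UNIV. L_contr h i p * x i)
      + (\<Sum>i\<in>UNIV. m_down f i p * N_can f i j p) * m_down f k p * x h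
      + (\<Sum>i\<in>UNIV. m_down f i p * N_can f i k p) * m_down f j p * x h" for h j k
    by (simp add: landsberg_def C sum_distrib_left sum_distrib_right algebra_simps)
  have \<mu>: "?\<mu> = (\<Sum>i\<in>UNIV. L_contr i i p) / 2 - ?FY"
  proof -
    have "?\<mu> = (\<Sum>i\<in>UNIV. L_contr i i p) / 2 * (\<Sum>i\<in>UNIV. m_down f i p * m_up f i p) - ?FY"
      unfolding bar0_m_up[OF p] by (simp add: sum_2 algebra_simps add_divide_distrib)
    then show ?thesis by (simp add: mm)
  qed
  have "2 * ?\<nu> = (\<Sum>i\<in>UNIV. \<Sum>j\<in>UNIV. m_down f i p * (2 * N_can f i j p) * m_up f j p)"
    by (simp add: sum_2 algebra_simps)
  also have "\<dots> = of_real (f p) * (scal_Y f p + scal_E f p)"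
    unfolding distrib_left N_can_eq[OF p] scal_JYE[OF p] by (simp add: sum_2 algebra_simps)
  \<comment> \<open>By the trace formula \<open>2 * ?\<mu>\<close> is
    \<open>F (J + Y) - 2 F Y\<close>; adding \<open>2 * ?\<nu> = F (Y + E)\<close> cancels
    \<open>Y\<close>.\<close>
  finally have \<mu>\<nu>: "2 * (?\<mu> + ?\<nu>) = of_real (f p) * (scal_J f p + scal_E f p)"
    unfolding distrib_left \<mu> trace_L_contr[OF p] scal_JYE(2)[OF p, symmetric] by (simp add: algebra_simps)
  \<comment> \<open>Leibniz rule with one triple sum for each of the four factors; they are
    evaluated in turn below.\<close>
  have "bar0 f (\<lambda>p. \<Sum>j\<in>UNIV. \<Sum>k\<in>UNIV. \<Sum>h\<in>UNIV. m_up f j p * m_up f k p * w h p * C_cf f h k j p) p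
    = (\<Sum>j\<in>UNIV. \<Sum>k\<in>UNIV. \<Sum>h\<in>UNIV. bar0 f (m_up f j) p * m_up f k p * w h p * C_cf f h k j p)
    + (\<Sum>j\<in>UNIV. \<Sum>k\<in>UNIV. \<Sum>h\<in>UNIV. m_up f j p * bar0 f (m_up f k) p * w h p * C_cf f h k j p)
    + (\<Sum>j\<in>UNIV. \<Sum>k\<in>UNIV. \<Sum>h\<in>UNIV. m_up f j p * m_up f k p * bar0 f (w h) p * C_cf f h k j p)
    + (\<Sum>j\<in>UNIV. \<Sum>k\<in>UNIV. \<Sum>h\<in>UNIV. m_up f j p * m_up f k p * w h p * bar0 f (C_cf f h k j) p)"
    by (subst bar0_sum bar0_mult, (intro finite differentiable_sum ballI differentiable_mult
        differentiable_frame[OF p] w smooth_differentiable[OF smooth_C_cf p])+)+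
      (simp add: sum.distrib distrib_right)
  also have "(\<Sum>j\<in>UNIV. \<Sum>k\<in>UNIV. \<Sum>h\<in>UNIV. bar0 f (m_up f j) p * m_up f k p * w h p * C_cf f h k j p)
      = ?\<mu> * (\<Sum>h\<in>UNIV. w h p * x h)"
    unfolding C contract mm by simp
  also have "(\<Sum>j\<in>UNIV. \<Sum>k\<in>UNIV. \<Sum>h\<in>UNIV. m_up f j p * bar0 f (m_up f k) p * w h p * C_cf f h k j p)
      = ?\<mu> * (\<Sum>h\<in>UNIV. w h p * x h)"
    unfolding C contract mult.commute[of "m_up f _ p" "m_down f _ p"] mm by (simp add: mult.commute)
  also have "(\<Sum>j\<in>UNIV. \<Sum>k\<in>UNIV. \<Sum>h\<in>UNIV. m_up f j p * m_up f k p * bar0 f (w h) p * C_cf f h k j p)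
      = (\<Sum>h\<in>UNIV. bar0 f (w h) p * x h)"
    unfolding C contract mult.commute[of "m_up f _ p" "m_down f _ p"] mm by simp
  also have "(\<Sum>j\<in>UNIV. \<Sum>k\<in>UNIV. \<Sum>h\<in>UNIV. m_up f j p * m_up f k p * w h p * bar0 f (C_cf f h k j) p)
      = (\<Sum>j\<in>UNIV. \<Sum>k\<in>UNIV. \<Sum>h\<in>UNIV. m_up f j p * m_up f k p * w h p * landsberg h k j p)
        - (\<Sum>j\<in>UNIV. \<Sum>k\<in>UNIV. \<Sum>h\<in>UNIV. m_up f j p * m_up f k p * w h p * (m_down f k p * m_down f j p * (\<Sum>i\<in>UNIV. L_contr h i p * x i)))
        + 2 * ?\<nu> * (\<Sum>i\<in>UNIV. m_down f i p * m_up f i p) * (\<Sum>h\<in>UNIV. w h p * x h)"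
    unfolding bar0_C by (simp add: sum_2 algebra_simps)
  also have "(\<Sum>j\<in>UNIV. \<Sum>k\<in>UNIV. \<Sum>h\<in>UNIV. m_up f j p * m_up f k p * w h p * (m_down f k p * m_down f j p * (\<Sum>i\<in>UNIV. L_contr h i p * x i)))
      = (\<Sum>h\<in>UNIV. w h p * (\<Sum>i\<in>UNIV. L_contr h i p * x i))"
    unfolding contract mult.commute[of "m_up f _ p" "m_down f _ p"] mm by simp
  finally show ?thesis
    unfolding mm \<mu>\<nu>[symmetric] by (simp add: sum_2 algebra_simps)
qed

section \<open>Frame components of \<open>landsberg\<close> and the two scalar equations\<close>

definition landsberg_l :: "2 pt \<Rightarrow> complex" where
  "landsberg_l p = (\<Sum>j\<in>UNIV. \<Sum>k\<in>UNIV. \<Sum>h\<in>UNIV. m_up f j p * m_up f k p * l_down f h p * landsberg h k j p)"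

definition landsberg_m :: "2 pt \<Rightarrow> complex" where
  "landsberg_m p = (\<Sum>j\<in>UNIV. \<Sum>k\<in>UNIV. \<Sum>h\<in>UNIV. m_up f j p * m_up f k p * m_down f h p * landsberg h k j p)"

lemma l_dot_AB:
  "p \<in> S \<Longrightarrow> (\<Sum>h\<in>UNIV. l_down f h p * (a * l_up f h p + b * m_up f h p)) = a"
  "p \<in> S \<Longrightarrow> (\<Sum>h\<in>UNIV. m_down f h p * (a * l_up f h p + b * m_up f h p)) = b"
  using l_dual[of p] sqrt_g_nz[of p] by (simp_all add: sum_2 m_components field_simps, algebra+)

text \<open>For \<open>w = l_down\<close> the last sum of \<open>bar0_C_contract\<close> vanishes,
  since \<open>bar0\<close> acts on \<open>l_down\<close> exactly through
  \<open>L_contr\<close>.\<close>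

lemma bar0_scal_A:
  assumes p: "p \<in> S"
  shows "bar0 f (scal_A f) p = landsberg_l p + of_real (f p) * scal_A f p * (scal_E f p + scal_J f p)"
  unfolding scal_A_def[abs_def] bar0_C_contract[OF p differentiable_frame(2)[OF p] refl] landsberg_l_def
  by (simp add: l_dot_AB[OF p] bar0_l_down[OF p])

text \<open>For \<open>w = m_down\<close> the last sum of \<open>bar0_C_contract\<close> is minus
  half the trace times \<open>B\<close>, that is \<open>- F B (J + Y) / 2\<close>.\<close>

lemma bar0_scal_B:
  assumes p: "p \<in> S"
  shows "bar0 f (scal_B f) p = landsberg_m p
    + of_real (f p) * scal_B f p * (scal_E f p + scal_J f p / 2 - scal_Y f p / 2)"
proof -
  \<comment> \<open>Renaming summation indices brings \<open>scal_B\<close> into the form treated by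
    \<open>bar0_C_contract\<close>.\<close>
  have B: "scal_B f = (\<lambda>p. \<Sum>j\<in>UNIV. \<Sum>k\<in>UNIV. \<Sum>h\<in>UNIV. m_up f j p * m_up f k p * m_down f h p * C_cf f h k j p)"
    by (simp add: fun_eq_iff scal_B_def sum_2 algebra_simps)
  let ?x = "\<lambda>h. scal_A f p * l_up f h p + scal_B f p * m_up f h p"
  have "(\<Sum>h\<in>UNIV. (bar0 f (m_down f h) p - (\<Sum>i\<in>UNIV. L_contr i h p * m_down f i p)) * ?x h)
      = - (\<Sum>i\<in>UNIV. L_contr i i p) / 2 * (\<Sum>h\<in>UNIV. m_down f h p * ?x h)"
    unfolding bar0_m_down[OF p] by (simp add: sum_2 field_simps)
  then have "bar0 f (scal_B f) p = landsberg_m p + of_real (f p) * (scal_J f p + scal_E f p) * scal_B f p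
      - of_real (f p) * (scal_J f p + scal_Y f p) / 2 * scal_B f p"
    by (subst B) (simp only: bar0_C_contract[OF p differentiable_frame(4)[OF p] refl] landsberg_m_def
        l_dot_AB[OF p] trace_L_contr[OF p], simp)
  then show ?thesis
    by (simp add: algebra_simps add_divide_distrib diff_divide_distrib)
qed

lemma landsberg_eq_0_iff:
  assumes p: "p \<in> S"
  shows "(\<forall>h j k. landsberg h j k p = 0) \<longleftrightarrow> landsberg_l p = 0 \<and> landsberg_m p = 0"
proof
  assume "\<forall>h j k. landsberg h j k p = 0"
  then show "landsberg_l p = 0 \<and> landsberg_m p = 0"
    by (simp add: landsberg_l_def landsberg_m_def)
next
  assume 0: "landsberg_l p = 0 \<and> landsberg_m p = 0"
  define x where "x h = (\<Sum>a\<in>UNIV. \<Sum>b\<in>UNIV. m_up f a p * m_up f b p * landsberg h b a p)" for h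
  have "landsberg h j k p = m_down f j p * m_down f k p * x h" for h j k
    unfolding x_def by (rule frame_symmetric[OF p landsberg_commute[OF p] landsberg_eta[OF p]])
  moreover have "(\<Sum>h\<in>UNIV. l_down f h p * x h) = 0" and "(\<Sum>h\<in>UNIV. m_down f h p * x h) = 0"
    using 0 unfolding x_def landsberg_l_def landsberg_m_def by (simp_all add: sum_2 algebra_simps)
  then have "x h = 0" for h
    using frame_expand[OF p, of x h] by simp
  ultimately show "\<forall>h j k. landsberg h j k p = 0"
    by simp
qed

text \<open>Moving the \<open>J + Y\<close> terms to the left turns \<open>E - Y\<close> into
  \<open>E + J\<close> and \<open>E + J / 2 - Y / 2\<close>, the factors in
  \<open>bar0_scal_A\<close> and \<open>bar0_scal_B\<close>; each equation then says that one frame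
  component of \<open>landsberg\<close> is zero.\<close>

lemma berwald_eq_rund_iff:
  assumes p: "p \<in> S"
  shows "(\<forall>i j k. L_berwald f i j k p = L_rund f i j k p) \<longleftrightarrow>
      (let Fp = complex_of_real (f p);
           A = scal_A f p; B = scal_B f p; J = scal_J f p; Y = scal_Y f p; E = scal_E f p
       in Fp * A * (E - Y) = bar0 f (scal_A f) p - Fp * A * (J + Y) \<and>
          Fp * B * (E - Y) = bar0 f (scal_B f) p - Fp * B / 2 * (J + Y))"
proof -
  have "(\<forall>i j k. L_berwald f i j k p = L_rund f i j k p) \<longleftrightarrow> (\<forall>h j k. landsberg h j k p = 0)"
    by (simp flip: berwald_minus_rund[OF p])
  then show ?thesis
    unfolding landsberg_eq_0_iff[OF p] Let_def bar0_scal_A[OF p] bar0_scal_B[OF p]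
    by (auto simp: field_simps)
qed

end

section \<open>From the manifold to charts\<close>

lemma chart_inv_chart_image:
  assumes "z \<in> chart_image c"
  shows "chart_inv c z \<in> fst c" and "snd c (chart_inv c z) = z"
  using assms unfolding chart_image_def chart_inv_def by (auto intro: inv_into_into f_inv_into_f)

lemma open_chart_image_subset:
  assumes c: "is_chart M c" and V: "openin M V" "V \<subseteq> fst c"
  shows "open (snd c ` V)"
proof -
  have "openin (subtopology M (fst c)) V"
    using c V by (simp add: is_chart_def openin_open_subtopology)
  then have "openin (top_of_set (chart_image c)) (snd c ` V)"
    using c homeomorphic_map_openness_eq unfolding is_chart_def by blast
  then show ?thesis
    using c by (simp add: is_chart_def openin_open_eq)
qed

lemma transition_chart:
  assumes "is_chart M c" and "q \<in> fst c"
  shows "transition c d (snd c q) = snd d q"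
proof -
  have "inj_on (snd c) (topspace (subtopology M (fst c)))"
    using assms(1) homeomorphic_imp_injective_map unfolding is_chart_def by blast
  moreover have "topspace (subtopology M (fst c)) = fst c"
    using assms(1) openin_subset by (auto simp: is_chart_def)
  ultimately show ?thesis
    using assms(2) by (simp add: transition_def chart_inv_def inv_into_f_f)
qed

lemma transition_derivative:
  assumes "complex_manifold M \<A>" "c \<in> \<A>" "d \<in> \<A>" "q \<in> fst c" "q \<in> fst d"
  shows "transition c d differentiable (at (snd c q))"
    and "frechet_derivative (transition c d) (at (snd c q)) (a *s v)
      = a *s frechet_derivative (transition c d) (at (snd c q)) v"
proof -
  have "holomorphic_map_on (transition c d) (snd c ` (fst c \<inter> fst d))"
    using assms by (auto simp: complex_manifold_def compatible_def)
  then obtain D where D: "(transition c d has_derivative D) (at (snd c q))"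
    and lin: "Vector_Spaces.linear (*s) (*s) D"
    using assms(4,5) unfolding holomorphic_map_on_def by blast
  show "transition c d differentiable (at (snd c q))"
    using D by (auto simp: differentiable_def)
  show "frechet_derivative (transition c d) (at (snd c q)) (a *s v)
      = a *s frechet_derivative (transition c d) (at (snd c q)) v"
    using lin unfolding frechet_derivative_at[OF D, symmetric]
      Vector_Spaces.linear_def module_hom_def module_hom_axioms_def by blast
qed

text \<open>Chain rule on the image of the triple overlap, where the change of coordinates factors
  through \<open>d\<close>. This cocycle law makes a family of components a tangent vector.\<close>

lemma transition_derivative_comp:
  assumes M: "complex_manifold M \<A>" and A: "c \<in> \<A>" "d \<in> \<A>" "e \<in> \<A>"
    and q: "q \<in> fst c" "q \<in> fst d" "q \<in> fst e"
  shows "frechet_derivative (transition c e) (at (snd c q)) v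
    = frechet_derivative (transition d e) (at (snd d q)) (frechet_derivative (transition c d) (at (snd c q)) v)"
proof -
  have ch: "is_chart M c" "is_chart M d" "is_chart M e"
    using M A by (auto simp: complex_manifold_def)
  define W where "W = snd c ` (fst c \<inter> fst d \<inter> fst e)"
  have "open W"
    unfolding W_def using ch by (intro open_chart_image_subset[OF ch(1)]) (auto simp: is_chart_def)
  moreover have "snd c q \<in> W" using q by (auto simp: W_def)
  moreover have "transition c e w = (transition d e \<circ> transition c d) w" if "w \<in> W" for w
    using that ch by (auto simp: W_def transition_chart)
  ultimately have "frechet_derivative (transition c e) (at (snd c q))
      = frechet_derivative (transition d e \<circ> transition c d) (at (snd c q))"
    using transition_derivative(1)[OF M A(1,3) q(1,3)]
    by (intro frechet_derivative_transform_within_open) auto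
  also have "\<dots> = frechet_derivative (transition d e) (at (snd d q)) \<circ> frechet_derivative (transition c d) (at (snd c q))"
    using transition_derivative(1)[OF M A(1,2) q(1,2)] transition_derivative(1)[OF M A(2,3) q(2,3)]
    by (subst frechet_derivative_compose) (simp_all add: transition_chart[OF ch(1) q(1)])
  finally show ?thesis by simp
qed

lemma transition_derivative_self:
  assumes M: "complex_manifold M \<A>" and A: "c \<in> \<A>" and q: "q \<in> fst c"
  shows "frechet_derivative (transition c c) (at (snd c q)) v = v"
proof -
  have ch: "is_chart M c"
    using M A by (auto simp: complex_manifold_def)
  have "frechet_derivative (transition c c) (at (snd c q)) = frechet_derivative (\<lambda>x. x) (at (snd c q))"
    using transition_derivative(1)[OF M A A q q] ch q
    by (intro frechet_derivative_transform_within_open[where X = "chart_image c"])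
      (auto simp: is_chart_def chart_image_def transition_chart[OF ch])
  then show ?thesis by simp
qed

lemma finsler_chart_local_rep:
  fixes F :: "'m \<times> ('m, 'n::finite) tangent \<Rightarrow> real"
  assumes F: "complex_finsler_space M \<A> F" and c: "c \<in> \<A>"
  shows "finsler_chart (chart_image c) (local_rep \<A> c F)"
proof
  have M: "complex_manifold M \<A>" using F by (simp add: complex_finsler_space_def)
  show "open (chart_image c)"
    using M c by (auto simp: complex_manifold_def is_chart_def)
  show "smooth_on (\<lambda>p. (local_rep \<A> c F p)\<^sup>2) (chart_image c \<times> (- {0}))"
    and "\<And>p. p \<in> chart_image c \<times> (- {0}) \<Longrightarrow> pos_def_hermitian (gmat (local_rep \<A> c F) p)"
    using F c unfolding complex_finsler_space_def by blast+
  fix z \<eta> a assume z: "z \<in> chart_image c"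
  define q where "q = chart_inv c z"
  \<comment> \<open>The tangent vector at \<open>q\<close> whose component in the chart
    \<open>c\<close> is \<eta>.\<close>
  define X where "X \<eta> = (\<lambda>d\<in>charts_at \<A> q. frechet_derivative (transition c d) (at z) \<eta>)" for \<eta>
  have q: "q \<in> fst c" and zq: "z = snd c q"
    using chart_inv_chart_image[OF z] by (simp_all add: q_def)
  have rep: "local_rep \<A> c F (z, \<eta>) = F (q, X \<eta>)" for \<eta>
    by (simp add: local_rep_def bundle_point_def Let_def q_def X_def)
  have "X \<eta> \<in> tangent_space \<A> q"
    unfolding tangent_space_def X_def zq
    by (intro CollectI conjI ballI)
      (simp_all add: charts_at_def transition_derivative_comp[OF M c _ _ q, symmetric])
  moreover have "q \<in> topspace M"
    using M c q by (auto simp: complex_manifold_def)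
  ultimately have X: "(q, X \<eta>) \<in> tangent_bundle M \<A>"
    by (simp add: tangent_bundle_def)
  \<comment> \<open>Derivatives of coordinate changes are complex linear, so scaling in coordinates
    agrees with scaling of tangent vectors.\<close>
  have "X (a *s \<eta>) = tangent_scale \<A> q a (X \<eta>)"
    unfolding X_def tangent_scale_def zq
    by (auto simp: fun_eq_iff restrict_def charts_at_def transition_derivative(2)[OF M c _ q])
  then show "local_rep \<A> c F (z, a *s \<eta>) = cmod a * local_rep \<A> c F (z, \<eta>)"
    using F X unfolding rep complex_finsler_space_def by fastforce
  show "0 < local_rep \<A> c F (z, \<eta>)" if "\<eta> \<noteq> 0"
  proof -
    \<comment> \<open>The component in \<open>c\<close> itself tells \<open>X \<eta>\<close> from
      the zero vector, because the change from \<open>c\<close> to \<open>c\<close> has the identity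
      as derivative.\<close>
    have "X \<eta> c = \<eta>" "tangent_zero \<A> q c = 0"
      using c q transition_derivative_self[OF M c q] by (simp_all add: X_def tangent_zero_def charts_at_def zq)
    with that have "X \<eta> \<noteq> tangent_zero \<A> q" by auto
    then have "F (q, X \<eta>) \<noteq> 0" and "0 \<le> F (q, X \<eta>)"
      using F X unfolding complex_finsler_space_def by blast+
    then show ?thesis by (simp add: rep)
  qed
qed

theorem theorem4p6:
  fixes M :: "'m topology"
    and \<A> :: "('m, 2) chart set"
    and F :: "'m \<times> ('m, 2) tangent \<Rightarrow> real"
  assumes "complex_finsler_space M \<A> F"
  shows "complex_landsberg_space M \<A> F \<longleftrightarrow>
    (\<forall>c\<in>\<A>. \<forall>p\<in>chart_image c \<times> (- {0}).
       let f = local_rep \<A> c F;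
           Fp = complex_of_real (f p);
           A = scal_A f p; B = scal_B f p; J = scal_J f p; Y = scal_Y f p; E = scal_E f p
       in Fp * A * (E - Y) = bar0 f (scal_A f) p - Fp * A * (J + Y) \<and>
          Fp * B * (E - Y) = bar0 f (scal_B f) p - Fp * B / 2 * (J + Y))"
proof -
  have chart: "finsler_chart_2 (chart_image c) (local_rep \<A> c F)" if "c \<in> \<A>" for c
    unfolding finsler_chart_2_def by (rule finsler_chart_local_rep[OF assms that])
  \<comment> \<open>Both sides are conditions at each point of each chart, so the equivalence is
    applied pointwise.\<close>
  show ?thesis
    using assms finsler_chart_2.berwald_eq_rund_iff[OF chart]
    unfolding complex_landsberg_space_def Let_def by simp
qed

end
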